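(* Let $\phi(q)=\Pi(q)$ be an identity of Rogers-Ramanujan type (with $\phi(q)$ a series and $\Pi(q)$ an infinite product or a sum of several infinite products). Suppose $\phi(q)$ is written in the form $$\phi(q)=\sum_{j=0}^\infty \frac{(-1)^{aj} q^{bj^2 + cj} \prod_{i=1}^r (d_i q^{e_i}; q^{k_i})_{j+l_i} }{(q^m;q^m)_j \prod_{i=1}^s (\delta_i q^{\epsilon_i}; q^{\kappa_i})_{j+\lambda_i}},$$ where $a=0$ or $1$; $b,m\in\mathbb{Z}_+$; $c\in\mathbb{Z}$; $d_i=\pm1$, $e_i,k_i\in\mathbb{Z}_+$, $l_i\in\mathbb{Z}$ for $1\le i\le r$; and $\delta_i=\pm1$, $\epsilon_i,\kappa_i\in\mathbb{Z}_+$, $\lambda_i\in\mathbb{Z}$ for $1\le i\le s$. Let $g=\gcd(m,k_1,\dots,k_r,\kappa_1,\dots,\kappa_s)$. Then $$f(q,t) = \sum_{j=0}^\infty \frac{(-1)^{aj} t^{2bj/g} q^{bj^2 + cj} \prod_{i=1}^r (d_i t^{k_i/g} q^{e_i}; q^{k_i})_{j+l_i} }{(t;q^m)_{j+1} \prod_{i=1}^s (\delta_i t^{\kappa_i/g} q^{\epsilon_i}; q^{\kappa_i})_{j+\lambda_i}}$$ is a two variable generalization of $\phi(q)$ satisfying the following three conditions: (1) $f(q,t)=\sum_{n=0}^\infty P_n(q)t^n$, where the $P_n(q)$ are polynomials; (2) $\phi(q)=\lim_{t\to1^-}(1-t)f(q,t)=\lim_{n\to\infty}P_n(q)=\Pi(q)$;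 (3) $f(q,t)$ satisfies a nonhomogeneous $q$-difference equation of the form $f(q,t)=R_1(q,t)+R_2(q,t)f(q,tq^k)$, where $R_1(q,t)$ and $R_2(q,t)$ are rational functions of $q$ and $t$ and $k\in\mathbb{Z}_+$.
   Context: $\mathbb{Z}_+$ denotes the positive integers, and $|q|<1$. The $q$-factorials are $(A;p)_\infty=\prod_{i=0}^\infty(1-Ap^i)$ and $(A;p)_n=(A;p)_\infty/(Ap^n;p)_\infty$ for every integer $n$ (so $(A;p)_n=\prod_{i=0}^{n-1}(1-Ap^i)$ for $n\ge 0$). An identity of Rogers-Ramanujan type is an identity $\phi(q)=\Pi(q)$, valid for $|q|<1$, expressing a $q$-series as an infinite product or a sum of several infinite products.
   Formalization: Stated for 0<|q|<1, assuming g divides 2b and e_i+k_i l_i>0 for all i. The P_n are Laurent polynomials in general, and polynomials when b+c>=0 and all epsilon_i+kappa_i lambda_i>=0. Condition (3) is claimed only when m=g. The printed claim fails without these conditions. *)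

theory Defs
  imports "HOL-Analysis.Analysis" "HOL-Computational_Algebra.Polynomial"
begin

text \<open>The \<open>q\<close>-factorials \<open>(A;p)\<^sub>\<infinity>\<close> and \<open>(A;p)\<^sub>n\<close> for integer \<open>n\<close>. For \<open>n < 0\<close> the quotient is
  \<open>1 / ((1 - A p\<^sup>-\<^sup>1) \<dots> (1 - A p\<^sup>n))\<close>; if one of these factors vanishes, division by zero makes
  \<open>(A;p)\<^sub>n = 0\<close> and hence also \<open>1 / (A;p)\<^sub>n = 0\<close>, which is the usual convention
  for a negative subscript in a denominator, as in \<open>1 / (q;q)\<^sub>n = 0\<close>.\<close>

definition qpoch_inf :: "complex \<Rightarrow> complex \<Rightarrow> complex" where
  "qpoch_inf A p = (\<Prod>i. 1 - A * p ^ i)"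

definition qpoch :: "complex \<Rightarrow> complex \<Rightarrow> int \<Rightarrow> complex" where
  "qpoch A p n = qpoch_inf A p / qpoch_inf (A * p powi n) p"

text \<open>Negative powers of \<open>q\<close> may occur (\<open>c\<close> and the subscript shifts are arbitrary integers), so
  \<open>q\<close> ranges over the punctured disc.\<close>

abbreviation qdisc :: "complex set" where
  "qdisc \<equiv> ball 0 1 - {0}"

text \<open>\<open>\<phi>(q) = \<Pi>(q)\<close> with \<open>\<Pi>(q)\<close> a sum of one or more convergent infinite products, whose
  factors (such as \<open>(1 - q\<^sup>n)\<^sup>-\<^sup>1\<close>) are rational functions of \<open>q\<close> without poles in the
  punctured disc.\<close>

definition rogers_ramanujan_identity :: "(complex \<Rightarrow> complex) \<Rightarrow> (complex \<Rightarrow> complex) \<Rightarrow> bool" where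
  "rogers_ramanujan_identity \<phi> \<psi> \<longleftrightarrow>
     (\<exists>N\<ge>1. \<exists>u v :: nat \<Rightarrow> nat \<Rightarrow> complex poly. \<forall>q\<in>qdisc.
        (\<forall>i<N. (\<forall>n. poly (v i n) q \<noteq> 0) \<and> convergent_prod (\<lambda>n. poly (u i n) q / poly (v i n) q)) \<and>
        \<psi> q = (\<Sum>i<N. \<Prod>n. poly (u i n) q / poly (v i n) q)) \<and>
     (\<forall>q\<in>qdisc. \<phi> q = \<psi> q)"

definition gcd_param :: "nat \<Rightarrow> nat \<Rightarrow> (nat \<Rightarrow> nat) \<Rightarrow> nat \<Rightarrow> (nat \<Rightarrow> nat) \<Rightarrow> nat" where
  "gcd_param m r k s \<kappa> = Gcd ({m} \<union> k ` {1..r} \<union> \<kappa> ` {1..s})"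

definition rr_series ::
  "nat \<Rightarrow> nat \<Rightarrow> int \<Rightarrow> nat \<Rightarrow> nat \<Rightarrow> (nat \<Rightarrow> int) \<Rightarrow> (nat \<Rightarrow> nat) \<Rightarrow> (nat \<Rightarrow> nat) \<Rightarrow> (nat \<Rightarrow> int) \<Rightarrow>
   nat \<Rightarrow> (nat \<Rightarrow> int) \<Rightarrow> (nat \<Rightarrow> nat) \<Rightarrow> (nat \<Rightarrow> nat) \<Rightarrow> (nat \<Rightarrow> int) \<Rightarrow> complex \<Rightarrow> complex" where
  "rr_series a b c m r d e k l s \<delta> \<epsilon> \<kappa> lam q =
     (\<Sum>j. (-1) ^ (a * j) * q powi (int b * int j ^ 2 + c * int j)
           * (\<Prod>i=1..r. qpoch (of_int (d i) * q ^ e i) (q ^ k i) (int j + l i))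
           / (qpoch (q ^ m) (q ^ m) (int j)
              * (\<Prod>i=1..s. qpoch (of_int (\<delta> i) * q ^ \<epsilon> i) (q ^ \<kappa> i) (int j + lam i))))"

text \<open>The exponents of \<open>t\<close> are natural number quotients; \<open>2 b div g\<close> is exact
  only when \<open>g\<close> divides \<open>2 b\<close>.\<close>

definition rr_gen_term ::
  "nat \<Rightarrow> nat \<Rightarrow> int \<Rightarrow> nat \<Rightarrow> nat \<Rightarrow> (nat \<Rightarrow> int) \<Rightarrow> (nat \<Rightarrow> nat) \<Rightarrow> (nat \<Rightarrow> nat) \<Rightarrow> (nat \<Rightarrow> int) \<Rightarrow>
   nat \<Rightarrow> (nat \<Rightarrow> int) \<Rightarrow> (nat \<Rightarrow> nat) \<Rightarrow> (nat \<Rightarrow> nat) \<Rightarrow> (nat \<Rightarrow> int) \<Rightarrow>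
   complex \<Rightarrow> complex \<Rightarrow> nat \<Rightarrow> complex" where
  "rr_gen_term a b c m r d e k l s \<delta> \<epsilon> \<kappa> lam q t j =
     (let g = gcd_param m r k s \<kappa> in
        (-1) ^ (a * j) * t ^ ((2 * b div g) * j) * q powi (int b * int j ^ 2 + c * int j)
        * (\<Prod>i=1..r. qpoch (of_int (d i) * t ^ (k i div g) * q ^ e i) (q ^ k i) (int j + l i))
        / (qpoch t (q ^ m) (int j + 1)
           * (\<Prod>i=1..s. qpoch (of_int (\<delta> i) * t ^ (\<kappa> i div g) * q ^ \<epsilon> i) (q ^ \<kappa> i) (int j + lam i))))"

definition rr_gen ::
  "nat \<Rightarrow> nat \<Rightarrow> int \<Rightarrow> nat \<Rightarrow> nat \<Rightarrow> (nat \<Rightarrow> int) \<Rightarrow> (nat \<Rightarrow> nat) \<Rightarrow> (nat \<Rightarrow> nat) \<Rightarrow> (nat \<Rightarrow> int) \<Rightarrow>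
   nat \<Rightarrow> (nat \<Rightarrow> int) \<Rightarrow> (nat \<Rightarrow> nat) \<Rightarrow> (nat \<Rightarrow> nat) \<Rightarrow> (nat \<Rightarrow> int) \<Rightarrow>
   complex \<Rightarrow> complex \<Rightarrow> complex" where
  "rr_gen a b c m r d e k l s \<delta> \<epsilon> \<kappa> lam q t =
     (\<Sum>j. rr_gen_term a b c m r d e k l s \<delta> \<epsilon> \<kappa> lam q t j)"

definition is_polynomial :: "(complex \<Rightarrow> complex) \<Rightarrow> bool" where
  "is_polynomial F \<longleftrightarrow> (\<exists>p. \<forall>q. F q = poly p q)"

definition is_laurent_polynomial :: "(complex \<Rightarrow> complex) \<Rightarrow> bool" where
  "is_laurent_polynomial F \<longleftrightarrow> (\<exists>p h. \<forall>q. q \<noteq> 0 \<longrightarrow> F q = poly p q / q ^ h)"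

text \<open>A bivariate polynomial is a polynomial in \<open>t\<close> whose coefficients are polynomials in \<open>q\<close>.
  The denominator is required to have no zero on the region \<open>0 < |q| < 1\<close>, \<open>|t| < 1\<close>.\<close>

definition poly2 :: "complex poly poly \<Rightarrow> complex \<Rightarrow> complex \<Rightarrow> complex" where
  "poly2 N q t = poly (poly N [:t:]) q"

definition is_rational_function2 :: "(complex \<Rightarrow> complex \<Rightarrow> complex) \<Rightarrow> bool" where
  "is_rational_function2 R \<longleftrightarrow>
     (\<exists>N D. \<forall>q\<in>qdisc. \<forall>t\<in>ball 0 1. poly2 D q t \<noteq> 0 \<and> R q t = poly2 N q t / poly2 D q t)"

end

theory Submission
  imports Defs "HOL-Complex_Analysis.Complex_Analysis"
begin

text \<open>
  Fix \<open>q\<close> and put \<open>h(t) = (1 - t) f(q,t)\<close>. The factor \<open>1 - t\<close> cancels the first factor of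
  \<open>(t;q\<^sup>m)\<^sub>j\<^sub>+\<^sub>1\<close>. Every other factor \<open>1 - x t\<^sup>K q\<^sup>E\<close> that stays in a denominator has
  \<open>x = 1\<close> or \<open>x = -1\<close> and \<open>E \<ge> 1\<close>, so it vanishes only where \<open>|t|\<close> exceeds 1 by an amount that
  does not depend on \<open>j\<close>. (For a numerator symbol of negative subscript this is the hypothesis
  \<open>e\<^sub>i + k\<^sub>i l\<^sub>i > 0\<close>.) Hence there is \<open>R > 1\<close> such that all terms of \<open>h\<close> are holomorphic for
  \<open>|t| < R\<close>. The quotients of q-factorials in them are bounded uniformly in \<open>j\<close>, because they are
  quotients of values of the entire function \<open>A \<mapsto> (A;p)\<^sub>\<infinity>\<close> on a fixed disc, and
  \<open>q\<close> to the power \<open>b j\<^sup>2 + c j\<close> beats the geometric growth of the power of \<open>t\<close>. So \<open>h\<close> is holomorphic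
  on a disc that contains the point 1 (\<open>reduced_terms_converge\<close>), and \<open>h(1) = \<phi>(q)\<close> term by term.

  Both limits follow at once: \<open>h\<close> is continuous at 1, and if \<open>h = \<Sum> C\<^sub>n t\<^sup>n\<close>, then the coefficients of
  \<open>f = h / (1 - t)\<close> are the partial sums \<open>P\<^sub>n = C\<^sub>0 + \<dots> + C\<^sub>n\<close>, which converge to \<open>h(1)\<close>
  (\<open>power_series_beyond_unit_disc\<close>).

  The \<open>C\<^sub>n\<close> are Laurent polynomials in \<open>q\<close> because the \<open>j\<close>-th term of \<open>h\<close> is divisible by \<open>t\<^sup>j\<close>, so
  only \<open>j \<le> n\<close> contribute, and each term is a finite product of factors \<open>1 - x t\<^sup>K q\<^sup>E\<close> and of
  inverses of such factors, to be expanded as geometric series in \<open>t\<close>. Negative powers of \<open>q\<close> can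
  come only from \<open>b j\<^sup>2 + c j\<close> and from denominator symbols with negative subscript, whose factors
  stand in the numerator; the conditions \<open>b + c \<ge> 0\<close> and \<open>\<epsilon>\<^sub>i + \<kappa>\<^sub>i \<lambda>\<^sub>i \<ge> 0\<close> exclude them
  (\<open>taylor_coefficients_of_reduced_terms\<close>).

  For the q-difference equation, replace \<open>t\<close> by \<open>t q\<^sup>g\<close>. This multiplies \<open>t\<close> to the power \<open>k\<^sub>i/g\<close> by
  \<open>q\<close> to the power \<open>k\<^sub>i\<close>, so it moves each q-factorial one step along its base, and it multiplies the
  power of \<open>t\<close> in the \<open>j\<close>-th term by \<open>q\<close> to the power \<open>2bj\<close>, the difference of two consecutive
  values of \<open>b j\<^sup>2\<close> up to a constant. If \<open>m = g\<close>, then \<open>(t;q\<^sup>m)\<^sub>j\<^sub>+\<^sub>1\<close> moves in the same way, and the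
  \<open>j\<close>-th term at \<open>t q\<^sup>g\<close> is the \<open>(j+1)\<close>-st term at \<open>t\<close> up to a rational factor that does not
  depend on \<open>j\<close> (\<open>gen_term_shift\<close>).
\<close>

section \<open>q-factorials\<close>

lemma summable_qpoch_factors:
  assumes "norm p < 1"
  shows "summable (\<lambda>i. norm ((1 - A * p ^ i) - 1 :: complex))"
  using assms by (simp add: norm_mult norm_power summable_mult summable_geometric)

lemma convergent_prod_qpoch_inf:
  assumes "norm p < 1"
  shows "convergent_prod (\<lambda>i. 1 - A * p ^ i :: complex)"
  by (intro abs_convergent_prod_imp_convergent_prod summable_imp_abs_convergent_prod
        summable_qpoch_factors assms)

lemma qpoch_inf_split:
  assumes "norm p < 1"
  shows "qpoch_inf A p = (\<Prod>i<n. 1 - A * p ^ i) * qpoch_inf (A * p ^ n) p"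
proof -
  have "(\<lambda>i. 1 - A * p ^ i) has_prod ((\<Prod>i<n. 1 - A * p ^ i) * (\<Prod>i. 1 - A * p ^ (i + n)))"
    by (rule has_prod_ignore_initial_segment'[OF convergent_prod_qpoch_inf[OF assms]])
  then show ?thesis
    unfolding qpoch_inf_def by (simp add: has_prod_iff power_add mult_ac)
qed

lemma qpoch_inf_split_head:
  assumes "norm p < 1"
  shows "qpoch_inf A p = (1 - A) * qpoch_inf (A * p) p"
  using qpoch_inf_split[OF assms, of A 1] by simp

lemma qpoch_inf_nonzero:
  assumes "norm p < 1" "norm A < 1"
  shows "qpoch_inf A p \<noteq> 0"
proof -
  have "1 - A * p ^ i \<noteq> 0" for i
  proof
    assume "1 - A * p ^ i = 0"
    then have "norm (A * p ^ i) = 1" by simp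
    moreover have "norm (A * p ^ i) \<le> norm A * 1"
      unfolding norm_mult norm_power using assms by (intro mult_left_mono power_le_one) auto
    ultimately show False using assms by simp
  qed
  then show ?thesis
    unfolding qpoch_inf_def using prodinf_nonzero convergent_prod_qpoch_inf assms by blast
qed

text \<open>
  Analyticity in \<open>A\<close> supplies all that is needed about infinite products: holomorphy in \<open>t\<close> by
  composition, and uniform bounds by compactness of closed discs.
\<close>

lemma qpoch_inf_entire:
  assumes "norm p < 1"
  shows "(\<lambda>A. qpoch_inf A p) holomorphic_on UNIV"
proof (rule holomorphic_uniform_sequence)
  show "(\<lambda>A. \<Prod>i<n. 1 - A * p ^ i) holomorphic_on UNIV" for n
    by (intro holomorphic_intros)
  fix x :: complex
  have "uniformly_convergent_on (cball x 1) (\<lambda>N A. \<Prod>n<N. 1 - A * p ^ n)"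
  proof (rule uniformly_convergent_on_prod')
    show "uniformly_convergent_on (cball x 1) (\<lambda>N A. \<Sum>n<N. norm ((1 - A * p ^ n) - 1))"
    proof (rule Weierstrass_m_test')
      show "summable (\<lambda>n. (norm x + 1) * norm p ^ n)"
        using assms by (intro summable_mult summable_geometric) auto
      fix n A assume "A \<in> cball x 1"
      then have "norm (A - x) \<le> 1" by (simp add: dist_norm norm_minus_commute)
      then have "norm A \<le> norm x + 1" using norm_triangle_sub[of A x] by linarith
      then show "norm (norm ((1 - A * p ^ n) - 1)) \<le> (norm x + 1) * norm p ^ n"
        by (simp add: norm_mult norm_power mult_right_mono)
    qed
  qed (auto intro!: continuous_intros)
  then obtain L where L: "uniform_limit (cball x 1) (\<lambda>N A. \<Prod>n<N. 1 - A * p ^ n) L sequentially"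
    by (auto simp: uniformly_convergent_on_def)
  have "L A = qpoch_inf A p" if "A \<in> cball x 1" for A
  proof -
    have "(\<lambda>N. \<Prod>n<N. 1 - A * p ^ n) \<longlonglongrightarrow> L A"
      by (rule tendsto_uniform_limitI[OF L that])
    moreover have "(\<lambda>N. \<Prod>n<N. 1 - A * p ^ n) \<longlonglongrightarrow> qpoch_inf A p"
      using convergent_prod_LIMSEQ[OF convergent_prod_qpoch_inf[OF assms, of A]]
        LIMSEQ_lessThan_iff_atMost[of "\<lambda>X. prod (\<lambda>n. 1 - A * p ^ n) X"]
      unfolding qpoch_inf_def by simp
    ultimately show ?thesis by (rule LIMSEQ_unique)
  qed
  then have "uniform_limit (cball x 1) (\<lambda>N A. \<Prod>n<N. 1 - A * p ^ n) (\<lambda>A. qpoch_inf A p) sequentially"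
    using L by (subst uniform_limit_cong'[where g = "\<lambda>N A. \<Prod>n<N. 1 - A * p ^ n" and i = L]) auto
  then show "\<exists>d>0. cball x d \<subseteq> UNIV \<and>
      uniform_limit (cball x d) (\<lambda>N A. \<Prod>n<N. 1 - A * p ^ n) (\<lambda>A. qpoch_inf A p) sequentially"
    by (intro exI[of _ 1]) auto
qed simp

lemma holomorphic_on_qpoch_inf [holomorphic_intros]:
  assumes "norm p < 1" "h holomorphic_on X"
  shows "(\<lambda>x. qpoch_inf (h x) p) holomorphic_on X"
  using holomorphic_on_compose_gen[OF assms(2) qpoch_inf_entire[OF assms(1)]]
  by (simp add: o_def)

lemma qpoch_inf_bounded:
  assumes "norm p < 1"
  obtains C where "C > 0" "\<And>A. norm A \<le> \<rho> \<Longrightarrow> norm (qpoch_inf A p) \<le> C"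
proof -
  have "continuous_on (cball 0 \<rho>) (\<lambda>A. qpoch_inf A p)"
    by (intro holomorphic_on_imp_continuous_on holomorphic_on_qpoch_inf holomorphic_on_ident assms)
  then have "bounded ((\<lambda>A. qpoch_inf A p) ` cball 0 \<rho>)"
    by (intro compact_imp_bounded compact_continuous_image) auto
  then show ?thesis using that unfolding bounded_pos by (auto simp: dist_norm)
qed

lemma qpoch_inf_bounded_away_from_0:
  assumes "norm p < 1" "\<rho> < 1"
  obtains C where "C > 0" "\<And>A. norm A \<le> \<rho> \<Longrightarrow> norm (1 / qpoch_inf A p) \<le> C"
proof -
  have "continuous_on (cball 0 \<rho>) (\<lambda>A. qpoch_inf A p)"
    by (intro holomorphic_on_imp_continuous_on holomorphic_on_qpoch_inf holomorphic_on_ident assms)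
  then have "continuous_on (cball 0 \<rho>) (\<lambda>A. 1 / qpoch_inf A p)"
    using qpoch_inf_nonzero[OF assms(1)] assms(2) by (intro continuous_intros) force+
  then have "bounded ((\<lambda>A. 1 / qpoch_inf A p) ` cball 0 \<rho>)"
    by (intro compact_imp_bounded compact_continuous_image) auto
  then show ?thesis using that unfolding bounded_pos by (auto simp: dist_norm)
qed

lemma qpoch_0:
  assumes "norm p < 1" "norm A < 1"
  shows "qpoch A p 0 = 1"
  using qpoch_inf_nonzero[OF assms] by (simp add: qpoch_def)

text \<open>
  This is the source of the q-difference equation: multiplying \<open>A\<close> by \<open>p\<close> is the same as
  increasing the subscript by 1, up to the factor \<open>1 - A\<close>. It holds even when
  \<open>(A p\<^sup>n\<^sup>+\<^sup>1;p)\<^sub>\<infinity> = 0\<close>, since both sides then have the value 0 of a division by zero.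
\<close>

lemma qpoch_shift_base:
  assumes "norm p < 1" "p \<noteq> 0"
  shows "(1 - A) * qpoch (A * p) p n = qpoch A p (n + 1)"
  using assms qpoch_inf_split_head[of p A]
  by (simp add: qpoch_def power_int_add mult_ac)

text \<open>
  One formula covers both signs of \<open>n\<close>, because one of the two integer intervals is always empty.
  For \<open>n < 0\<close> the second product may vanish; it does so exactly when \<open>(A p\<^sup>n;p)\<^sub>\<infinity> = 0\<close>, and then
  division by zero makes both sides 0.
\<close>

lemma qpoch_eq_finite_prods:
  assumes p: "norm p < 1" "p \<noteq> 0" and A: "norm A < 1"
  shows "qpoch A p n = (\<Prod>i\<in>{0..<n}. 1 - A * p powi i) / (\<Prod>i\<in>{n..<0}. 1 - A * p powi i)"
proof (cases "n \<ge> 0")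
  case True
  then obtain N where n: "n = int N" using nonneg_int_cases by blast
  have "qpoch_inf A p = (\<Prod>i<N. 1 - A * p ^ i) * qpoch_inf (A * p ^ N) p"
    by (rule qpoch_inf_split[OF p(1)])
  moreover have "(\<Prod>i\<in>{0..<n}. 1 - A * p powi i) = (\<Prod>i<N. 1 - A * p ^ i)"
    by (rule prod.reindex_bij_witness[of _ int nat]) (auto simp: n power_int_nonneg_exp)
  ultimately show ?thesis
    using qpoch_inf_nonzero[OF p(1) A] by (auto simp: qpoch_def n)
next
  case False
  define N where "N = nat (- n)"
  have n: "n = - int N" using False by (simp add: N_def)
  have "qpoch_inf (A * p powi n) p
      = (\<Prod>i<N. 1 - A * p powi n * p ^ i) * qpoch_inf (A * p powi n * p ^ N) p"
    by (rule qpoch_inf_split[OF p(1)])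
  moreover have "A * p powi n * p ^ N = A"
    using p by (simp add: n power_int_minus)
  moreover have "(\<Prod>i\<in>{n..<0}. 1 - A * p powi i) = (\<Prod>i<N. 1 - A * p powi n * p ^ i)"
  proof (rule prod.reindex_bij_witness[of _ "\<lambda>i. int i + n" "\<lambda>i. nat (i - n)"])
    fix i assume "i \<in> {n..<0}"
    then have "p powi i = p powi (n + int (nat (i - n)))" by simp
    also have "\<dots> = p powi n * p powi int (nat (i - n))"
      using p by (intro power_int_add) auto
    finally show "1 - A * p powi n * p ^ nat (i - n) = 1 - A * p powi i"
      by (simp only: power_int_of_nat mult.assoc)
  qed (auto simp: n)
  ultimately show ?thesis
    using qpoch_inf_nonzero[OF p(1) A] False by (auto simp: qpoch_def)
qed

section \<open>Symbols whose argument is a monomial in t and q\<close>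

lemma norm_monomial_le:
  fixes q t :: complex
  assumes "q \<in> qdisc" "d = 1 \<or> d = -1" "E \<ge> E'" "norm t \<le> R"
  shows "norm (of_int d * t ^ K * q powi E) \<le> R ^ K * norm q powi E'"
proof -
  have "norm q powi E \<le> norm q powi E'"
    using assms by (intro power_int_decreasing) auto
  then have "norm t ^ K * norm q powi E \<le> R ^ K * norm q powi E'"
    using assms order_trans[OF norm_ge_zero assms(4)] by (intro mult_mono power_mono) auto
  moreover have "norm (of_int d :: complex) = 1"
    using assms(2) by auto
  ultimately show ?thesis
    by (simp add: norm_mult norm_power norm_power_int)
qed

lemma monomial_shift:
  fixes q t :: complex
  assumes "q \<noteq> 0"
  shows "of_int d * t ^ K * q ^ e * (q ^ k) powi i = of_int d * t ^ K * q powi (int e + int k * i)"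
  using assms by (simp add: power_int_add power_int_power mult.assoc)

lemma norm_power_less_1:
  fixes q :: complex
  assumes "q \<in> qdisc" "k \<ge> 1"
  shows "norm (q ^ k) < 1" "q ^ k \<noteq> 0"
  using assms by (auto simp: norm_power power_less_one_iff)

lemma qpoch_monomial:
  fixes q t :: complex
  assumes "q \<in> qdisc" "d = 1 \<or> d = -1" "e \<ge> 1" "k \<ge> 1" "norm t ^ K * norm q < 1"
  shows "qpoch (of_int d * t ^ K * q ^ e) (q ^ k) n =
    (\<Prod>i\<in>{0..<n}. 1 - of_int d * t ^ K * q powi (int e + int k * i)) /
    (\<Prod>i\<in>{n..<0}. 1 - of_int d * t ^ K * q powi (int e + int k * i))"
proof -
  have "norm (of_int d * t ^ K * q ^ e) < 1"
    using norm_monomial_le[of q d 1 "int e" t "norm t" K] assms by simp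
  with assms norm_power_less_1[of q k] show ?thesis
    by (simp add: qpoch_eq_finite_prods monomial_shift)
qed

lemma norm_t_power_less_1:
  fixes q t :: complex
  assumes "q \<in> qdisc" "t \<in> ball 0 1"
  shows "norm t ^ K * norm q < 1"
proof -
  have "norm t ^ K * norm q \<le> 1 * norm q"
    using assms by (intro mult_right_mono power_le_one) auto
  also have "\<dots> < 1" using assms by simp
  finally show ?thesis .
qed

section \<open>Taylor coefficients in a ring of functions of q\<close>

text \<open>
  The set \<open>S\<close> is either the polynomials or the Laurent polynomials. Working with an abstract ring of
  functions of \<open>q\<close> gives one and the same family \<open>P\<^sub>n\<close> in both cases.
\<close>

locale coefficient_ring =
  fixes S :: "(complex \<Rightarrow> complex) set"
  assumes const [simp]: "(\<lambda>_. c) \<in> S"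
    and monomial [simp]: "(\<lambda>q. q ^ n) \<in> S"
    and add: "F \<in> S \<Longrightarrow> G \<in> S \<Longrightarrow> (\<lambda>q. F q + G q) \<in> S"
    and mult: "F \<in> S \<Longrightarrow> G \<in> S \<Longrightarrow> (\<lambda>q. F q * G q) \<in> S"
begin

lemma uminus: "F \<in> S \<Longrightarrow> (\<lambda>q. - F q) \<in> S"
  using mult[OF const[of "-1"], of F] by simp

lemma sum: "(\<And>i. i \<in> I \<Longrightarrow> F i \<in> S) \<Longrightarrow> (\<lambda>q. \<Sum>i\<in>I. F i q) \<in> S"
  by (induction I rule: infinite_finite_induct) (auto intro!: add)

text \<open>
  The powers of \<open>q\<close> that \<open>S\<close> contains. Agreement is asked on the punctured disc only, since for
  \<open>E < 0\<close> the value of \<open>q powi E\<close> at 0 is a convention.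
\<close>

definition exponent :: "int \<Rightarrow> bool" where
  "exponent E \<longleftrightarrow> (\<exists>u\<in>S. \<forall>q\<in>qdisc. u q = q powi E)"

lemma exponent_nonneg:
  assumes "E \<ge> 0"
  shows "exponent E"
proof -
  obtain n where "E = int n" using assms nonneg_int_cases by blast
  then show ?thesis
    unfolding exponent_def by (intro bexI[OF _ monomial[of n]]) auto
qed

text \<open>
  The \<open>n\<close>-th coefficient of the expansion in \<open>t\<close> must be one function in \<open>S\<close> for all \<open>q\<close>, whereas
  the radius of convergence may depend on \<open>q\<close>.
\<close>

definition taylor_in :: "(complex \<Rightarrow> complex \<Rightarrow> complex) \<Rightarrow> bool" where
  "taylor_in G \<longleftrightarrow> (\<exists>\<Phi>. (\<forall>n. \<Phi> n \<in> S) \<and>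
     (\<forall>q\<in>qdisc. G q has_fps_expansion Abs_fps (\<lambda>n. \<Phi> n q)))"

lemma taylor_in_cong:
  assumes "taylor_in G" "\<And>q t. q \<in> qdisc \<Longrightarrow> t \<in> ball 0 1 \<Longrightarrow> G q t = H q t"
  shows "taylor_in H"
proof -
  have "G q has_fps_expansion F \<longleftrightarrow> H q has_fps_expansion F" if "q \<in> qdisc" for q F
  proof (intro has_fps_expansion_cong refl)
    have "eventually (\<lambda>t. t \<in> ball 0 1) (nhds (0 :: complex))"
      by (intro eventually_nhds_in_open) auto
    then show "eventually (\<lambda>t. G q t = H q t) (nhds 0)"
      by eventually_elim (use assms that in auto)
  qed
  with assms(1) show ?thesis unfolding taylor_in_def by simp
qed

lemma taylor_in_scaled_powi:
  assumes "exponent E"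
  shows "taylor_in (\<lambda>q t. z * q powi E)"
proof -
  from assms obtain u where u: "u \<in> S" "\<forall>q\<in>qdisc. u q = q powi E"
    unfolding exponent_def by blast
  show ?thesis unfolding taylor_in_def
  proof (intro exI[of _ "\<lambda>n q. if n = 0 then z * u q else 0"] conjI allI ballI)
    fix q assume "q \<in> qdisc"
    then have "Abs_fps (\<lambda>n. if n = 0 then z * u q else 0) = fps_const (z * q powi E)"
      using u by (auto simp: fps_eq_iff)
    then show "(\<lambda>t. z * q powi E) has_fps_expansion Abs_fps (\<lambda>n. if n = 0 then z * u q else 0)"
      by simp
  next
    show "(\<lambda>q. if n = 0 then z * u q else 0) \<in> S" for n
      using mult[OF const u(1)] by (cases "n = 0") simp_all
  qed
qed

lemma taylor_in_1: "taylor_in (\<lambda>q t. 1)"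
  using taylor_in_scaled_powi[of 0 1] exponent_nonneg[of 0] by simp

lemma taylor_in_mult:
  assumes "taylor_in G" "taylor_in H"
  shows "taylor_in (\<lambda>q t. G q t * H q t)"
proof -
  from assms obtain \<Phi> \<Psi> where
    \<Phi>: "\<And>n. \<Phi> n \<in> S" "\<And>q. q \<in> qdisc \<Longrightarrow> G q has_fps_expansion Abs_fps (\<lambda>n. \<Phi> n q)" and
    \<Psi>: "\<And>n. \<Psi> n \<in> S" "\<And>q. q \<in> qdisc \<Longrightarrow> H q has_fps_expansion Abs_fps (\<lambda>n. \<Psi> n q)"
    unfolding taylor_in_def by blast
  show ?thesis unfolding taylor_in_def
  proof (intro exI[of _ "\<lambda>n q. \<Sum>i=0..n. \<Phi> i q * \<Psi> (n - i) q"] conjI allI ballI)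
    fix q assume q: "q \<in> qdisc"
    have "Abs_fps (\<lambda>n. \<Sum>i=0..n. \<Phi> i q * \<Psi> (n - i) q) = Abs_fps (\<lambda>n. \<Phi> n q) * Abs_fps (\<lambda>n. \<Psi> n q)"
      by (simp add: fps_eq_iff fps_mult_nth)
    then show "(\<lambda>t. G q t * H q t) has_fps_expansion Abs_fps (\<lambda>n. \<Sum>i=0..n. \<Phi> i q * \<Psi> (n - i) q)"
      using has_fps_expansion_mult[OF \<Phi>(2)[OF q] \<Psi>(2)[OF q]] by simp
  qed (auto intro!: sum mult \<Phi> \<Psi>)
qed

lemma taylor_in_prod:
  assumes "\<And>i. i \<in> I \<Longrightarrow> taylor_in (G i)"
  shows "taylor_in (\<lambda>q t. \<Prod>i\<in>I. G i q t)"
  using assms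
  by (induction I rule: infinite_finite_induct) (auto intro!: taylor_in_mult taylor_in_1)

text \<open>
  The coefficients of an inverse series are given by a recursion that divides by the constant
  coefficient only; as this is 1, the recursion does not leave \<open>S\<close>.
\<close>

lemma inverse_coefficients:
  assumes "\<And>n. \<Phi> n \<in> S" "\<And>q. \<Phi> 0 q = 1"
  shows "(\<lambda>q. fps_nth (inverse (Abs_fps (\<lambda>n. \<Phi> n q))) n) \<in> S"
proof (induction n rule: less_induct)
  case (less n)
  show ?case
  proof (cases n)
    case 0
    then show ?thesis using assms(2) by simp
  next
    case (Suc n')
    have "(\<lambda>q. fps_nth (inverse (Abs_fps (\<lambda>n. \<Phi> n q))) n) =
      (\<lambda>q. - (\<Sum>i=1..n. \<Phi> i q * fps_nth (inverse (Abs_fps (\<lambda>n. \<Phi> n q))) (n - i)))"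
      using assms(2) by (simp add: fps_inverse_def Suc)
    also have "\<dots> \<in> S"
      by (intro uminus sum mult assms less) auto
    finally show ?thesis .
  qed
qed

lemma taylor_in_factor:
  assumes "exponent E" "K \<ge> 1"
  shows "taylor_in (\<lambda>q t. 1 - of_int d * t ^ K * q powi E)"
    and "taylor_in (\<lambda>q t. 1 / (1 - of_int d * t ^ K * q powi E))"
proof -
  from assms obtain u where u: "u \<in> S" "\<forall>q\<in>qdisc. u q = q powi E"
    unfolding exponent_def by blast
  define \<Phi> where "\<Phi> = (\<lambda>n q. if n = 0 then 1 else if n = K then - (of_int d * u q) else 0)"
  have \<Phi>: "\<Phi> n \<in> S" for n
  proof -
    have "(\<lambda>q. - (of_int d * u q)) \<in> S" by (intro uminus mult u const)
    then show ?thesis unfolding \<Phi>_def by (cases "n = 0"; cases "n = K") simp_all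
  qed
  have exp: "(\<lambda>t. 1 - of_int d * t ^ K * q powi E) has_fps_expansion Abs_fps (\<lambda>n. \<Phi> n q)"
    if q: "q \<in> qdisc" for q
  proof -
    have "Abs_fps (\<lambda>n. \<Phi> n q) = 1 - fps_const (of_int d) * fps_X ^ K * fps_const (q powi E)"
      using assms(2) u q by (auto simp: fps_eq_iff \<Phi>_def fps_X_power_nth)
    then show ?thesis by (auto intro!: fps_expansion_intros)
  qed
  show "taylor_in (\<lambda>q t. 1 - of_int d * t ^ K * q powi E)"
    unfolding taylor_in_def using \<Phi> exp by blast
  show "taylor_in (\<lambda>q t. 1 / (1 - of_int d * t ^ K * q powi E))"
    unfolding taylor_in_def
  proof (intro exI[of _ "\<lambda>n q. fps_nth (inverse (Abs_fps (\<lambda>n. \<Phi> n q))) n"] conjI allI ballI)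
    show "(\<lambda>q. fps_nth (inverse (Abs_fps (\<lambda>n. \<Phi> n q))) n) \<in> S" for n
      by (rule inverse_coefficients[OF \<Phi>]) (simp add: \<Phi>_def)
    fix q assume "q \<in> qdisc"
    from has_fps_expansion_inverse[OF exp[OF this]]
    show "(\<lambda>t. 1 / (1 - of_int d * t ^ K * q powi E)) has_fps_expansion
        Abs_fps (fps_nth (inverse (Abs_fps (\<lambda>n. \<Phi> n q))))"
      by (simp add: \<Phi>_def inverse_eq_divide fps_nth_inverse)
  qed
qed

text \<open>
  By the positivity hypothesis no exponent in the finite products is negative, neither for \<open>n \<ge> 0\<close>
  nor for \<open>n < 0\<close>. So the coefficients are polynomials, whatever \<open>S\<close> is.
\<close>

lemma taylor_in_qpoch:
  assumes "d = 1 \<or> d = -1" "e \<ge> 1" "k \<ge> 1" "K \<ge> 1" "int e + int k * n > 0"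
  shows "taylor_in (\<lambda>q t. qpoch (of_int d * t ^ K * q ^ e) (q ^ k) n)"
proof -
  have ge: "int e + int k * i \<ge> int e + int k * n" if "i \<ge> n" for i
    using that by (simp add: mult_left_mono)
  show ?thesis
  proof (rule taylor_in_cong)
    show "taylor_in (\<lambda>q t. (\<Prod>i\<in>{0..<n}. 1 - of_int d * t ^ K * q powi (int e + int k * i)) *
      (\<Prod>i\<in>{n..<0}. 1 / (1 - of_int d * t ^ K * q powi (int e + int k * i))))"
    proof (intro taylor_in_mult taylor_in_prod taylor_in_factor exponent_nonneg)
      show "0 \<le> int e + int k * i" if "i \<in> {n..<0}" for i
        by (rule order_trans[OF less_imp_le[OF assms(5)] ge]) (use that in auto)
    qed (use assms in auto)
  qed (use assms in \<open>simp add: qpoch_monomial norm_t_power_less_1 prod_dividef\<close>)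
qed

text \<open>
  For \<open>n < 0\<close> the inverse symbol is a product of factors with exponents from \<open>e + k n\<close> upwards, and
  these may be negative. Only such symbols force Laurent polynomials.
\<close>

lemma taylor_in_inverse_qpoch:
  assumes "d = 1 \<or> d = -1" "e \<ge> 1" "k \<ge> 1" "K \<ge> 1" "\<And>E. E \<ge> int e + int k * n \<Longrightarrow> exponent E"
  shows "taylor_in (\<lambda>q t. 1 / qpoch (of_int d * t ^ K * q ^ e) (q ^ k) n)"
proof -
  have ge: "int e + int k * i \<ge> int e + int k * n" if "i \<ge> n" for i
    using that by (simp add: mult_left_mono)
  show ?thesis
  proof (rule taylor_in_cong)
    show "taylor_in (\<lambda>q t. (\<Prod>i\<in>{0..<n}. 1 / (1 - of_int d * t ^ K * q powi (int e + int k * i))) *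
      (\<Prod>i\<in>{n..<0}. 1 - of_int d * t ^ K * q powi (int e + int k * i)))"
    proof (intro taylor_in_mult taylor_in_prod taylor_in_factor)
      show "exponent (int e + int k * i)" if "i \<in> {0..<n}" for i
        using that by (intro exponent_nonneg) auto
      show "exponent (int e + int k * i)" if "i \<in> {n..<0}" for i
        using that by (intro assms(5) ge) auto
    qed (use assms in auto)
  qed (use assms in \<open>simp add: qpoch_monomial norm_t_power_less_1 prod_dividef\<close>)
qed

text \<open>
  The power of \<open>t\<close> in front of the \<open>j\<close>-th term makes its low coefficients vanish, so that each
  coefficient of the whole series is a finite sum over \<open>j\<close>.
\<close>

lemma taylor_in_shift:
  assumes "taylor_in G" "\<And>q t. F q t = t ^ K * G q t"
  shows "\<exists>\<Phi>. (\<forall>n. \<Phi> n \<in> S) \<and> (\<forall>n q. n < K \<longrightarrow> \<Phi> n q = 0) \<and>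
     (\<forall>q\<in>qdisc. F q has_fps_expansion Abs_fps (\<lambda>n. \<Phi> n q))"
proof -
  from assms(1) obtain \<Psi> where \<Psi>: "\<And>n. \<Psi> n \<in> S"
      "\<And>q. q \<in> qdisc \<Longrightarrow> G q has_fps_expansion Abs_fps (\<lambda>n. \<Psi> n q)"
    unfolding taylor_in_def by blast
  show ?thesis
  proof (intro exI[of _ "\<lambda>n q. if n < K then 0 else \<Psi> (n - K) q"] conjI allI ballI impI)
    show "(\<lambda>q. if n < K then 0 else \<Psi> (n - K) q) \<in> S" for n
      using \<Psi>(1)[of "n - K"] by (cases "n < K") simp_all
  next
    fix q assume q: "q \<in> qdisc"
    have "Abs_fps (\<lambda>n. if n < K then 0 else \<Psi> (n - K) q) = fps_X ^ K * Abs_fps (\<lambda>n. \<Psi> n q)"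
      by (auto simp: fps_eq_iff fps_X_power_mult_nth)
    moreover have "F q = (\<lambda>t. t ^ K * G q t)" by (rule ext) (rule assms(2))
    ultimately show "F q has_fps_expansion Abs_fps (\<lambda>n. if n < K then 0 else \<Psi> (n - K) q)"
      using \<Psi>(2)[OF q] by (auto intro!: fps_expansion_intros)
  qed auto
qed

end

lemma coefficient_ring_polynomials: "coefficient_ring {F. is_polynomial F}"
proof
  show "(\<lambda>_. c) \<in> {F. is_polynomial F}" for c
    unfolding is_polynomial_def by (auto intro!: exI[of _ "[:c:]"])
  show "(\<lambda>q. q ^ n) \<in> {F. is_polynomial F}" for n
    unfolding is_polynomial_def by (auto intro!: exI[of _ "monom 1 n"] simp: poly_monom)
  fix F G assume "F \<in> {F. is_polynomial F}" "G \<in> {F. is_polynomial F}"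
  then obtain x y where "\<And>q. F q = poly x q" "\<And>q. G q = poly y q"
    unfolding is_polynomial_def by auto
  then show "(\<lambda>q. F q + G q) \<in> {F. is_polynomial F}" "(\<lambda>q. F q * G q) \<in> {F. is_polynomial F}"
    unfolding is_polynomial_def mem_Collect_eq by (metis poly_add, metis poly_mult)
qed

lemma polynomial_imp_laurent:
  assumes "is_polynomial F"
  shows "is_laurent_polynomial F"
proof -
  from assms obtain p where "\<And>q. F q = poly p q" unfolding is_polynomial_def by auto
  then show ?thesis
    unfolding is_laurent_polynomial_def by (intro exI[of _ p] exI[of _ 0]) simp
qed

lemma coefficient_ring_laurent: "coefficient_ring {F. is_laurent_polynomial F}"
proof
  show "(\<lambda>_. c) \<in> {F. is_laurent_polynomial F}" for c
    using coefficient_ring.const[OF coefficient_ring_polynomials] polynomial_imp_laurent by blast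
  show "(\<lambda>q. q ^ n) \<in> {F. is_laurent_polynomial F}" for n
    using coefficient_ring.monomial[OF coefficient_ring_polynomials] polynomial_imp_laurent by blast
  fix F G assume "F \<in> {F. is_laurent_polynomial F}" "G \<in> {F. is_laurent_polynomial F}"
  then obtain x y m n where "\<And>q. q \<noteq> 0 \<Longrightarrow> F q = poly x q / q ^ m" "\<And>q. q \<noteq> 0 \<Longrightarrow> G q = poly y q / q ^ n"
    unfolding is_laurent_polynomial_def by auto
  then have "\<forall>q. q \<noteq> 0 \<longrightarrow> F q + G q = poly (x * monom 1 n + y * monom 1 m) q / q ^ (m + n)"
      "\<forall>q. q \<noteq> 0 \<longrightarrow> F q * G q = poly (x * y) q / q ^ (m + n)"
    by (simp_all add: poly_monom divide_simps power_add) (simp_all add: algebra_simps)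
  then show "(\<lambda>q. F q + G q) \<in> {F. is_laurent_polynomial F}"
      "(\<lambda>q. F q * G q) \<in> {F. is_laurent_polynomial F}"
    unfolding is_laurent_polynomial_def by blast+
qed

lemma exponent_laurent: "coefficient_ring.exponent {F. is_laurent_polynomial F} E"
proof (cases "E \<ge> 0")
  case True
  then show ?thesis by (rule coefficient_ring.exponent_nonneg[OF coefficient_ring_laurent])
next
  case False
  then have "q powi E = poly 1 q / q ^ nat (- E)" for q :: complex
    by (simp add: power_int_def field_simps)
  then have "is_laurent_polynomial (\<lambda>q. q powi E)"
    unfolding is_laurent_polynomial_def by blast
  then show ?thesis
    unfolding coefficient_ring.exponent_def[OF coefficient_ring_laurent]
    by (intro bexI[of _ "\<lambda>q. q powi E"]) auto
qed

section \<open>Uniformly bounded families of holomorphic functions\<close>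

definition bounded_holomorphic_family :: "real \<Rightarrow> (nat \<Rightarrow> complex \<Rightarrow> complex) \<Rightarrow> bool" where
  "bounded_holomorphic_family R F \<longleftrightarrow>
     (\<forall>j. F j holomorphic_on ball 0 R) \<and> (\<exists>C\<ge>0. \<forall>j. \<forall>t\<in>ball 0 R. norm (F j t) \<le> C)"

lemma bounded_holomorphic_family_mult:
  assumes "bounded_holomorphic_family R F" "bounded_holomorphic_family R G"
  shows "bounded_holomorphic_family R (\<lambda>j t. F j t * G j t)"
proof -
  from assms obtain C D where "C \<ge> 0" "D \<ge> 0"
      "\<And>j t. t \<in> ball 0 R \<Longrightarrow> norm (F j t) \<le> C"
      "\<And>j t. t \<in> ball 0 R \<Longrightarrow> norm (G j t) \<le> D"
    unfolding bounded_holomorphic_family_def by blast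
  then have "norm (F j t * G j t) \<le> C * D" if "t \<in> ball 0 R" for j t
    unfolding norm_mult using that by (intro mult_mono) auto
  moreover have "C * D \<ge> 0" using \<open>C \<ge> 0\<close> \<open>D \<ge> 0\<close> by simp
  ultimately have "\<exists>C\<ge>0. \<forall>j. \<forall>t\<in>ball 0 R. norm (F j t * G j t) \<le> C" by blast
  with assms show ?thesis
    unfolding bounded_holomorphic_family_def by (auto intro!: holomorphic_intros)
qed

lemma bounded_holomorphic_family_prod:
  assumes "\<And>i. i \<in> I \<Longrightarrow> bounded_holomorphic_family R (F i)"
  shows "bounded_holomorphic_family R (\<lambda>j t. \<Prod>i\<in>I. F i j t)"
  using assms
proof (induction I rule: infinite_finite_induct)
  case (insert i I)
  then show ?case by (simp add: bounded_holomorphic_family_mult)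
qed (auto simp: bounded_holomorphic_family_def intro!: holomorphic_intros exI[of _ 1])

text \<open>
  The symbol is a quotient of two values of \<open>A \<mapsto> (A;p)\<^sub>\<infinity>\<close>. By the positivity hypothesis both
  arguments lie in the disc of radius \<open>R\<^sup>K |q| < 1\<close> for every \<open>j\<close>. There the function is bounded and
  bounded away from 0.
\<close>

lemma bounded_holomorphic_family_qpoch:
  assumes q: "q \<in> qdisc" and d: "d = 1 \<or> d = -1" and e: "e \<ge> 1" and k: "k \<ge> 1"
    and l: "int e + int k * l > 0" and R: "R ^ K * norm q < 1"
  shows "bounded_holomorphic_family R (\<lambda>j t. qpoch (of_int d * t ^ K * q ^ e) (q ^ k) (int j + l))"
proof -
  define A where "A = (\<lambda>n t. of_int d * t ^ K * q powi (int e + int k * n))"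
  note p = norm_power_less_1[OF q k]
  have qpoch: "qpoch (of_int d * t ^ K * q ^ e) (q ^ k) n = qpoch_inf (A 0 t) (q ^ k) / qpoch_inf (A n t) (q ^ k)" for n t
    using q by (simp add: qpoch_def A_def monomial_shift)
  have norm_A: "norm (A n t) \<le> R ^ K * norm q" if "t \<in> ball 0 R" "int e + int k * n > 0" for n t
    using norm_monomial_le[of q d 1 "int e + int k * n" t R K] that q d unfolding A_def by simp
  have pos: "int e + int k * (int j + l) > 0" for j
    using l by (rule less_le_trans) (simp add: distrib_left)
  have nz: "qpoch_inf (A n t) (q ^ k) \<noteq> 0" if "t \<in> ball 0 R" "int e + int k * n > 0" for n t
    using norm_A[OF that] R p by (intro qpoch_inf_nonzero) auto
  obtain C where C: "C > 0" "\<And>A. norm A \<le> R ^ K * norm q \<Longrightarrow> norm (qpoch_inf A (q ^ k)) \<le> C"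
    using qpoch_inf_bounded[OF p(1)] by metis
  obtain D where D: "D > 0" "\<And>A. norm A \<le> R ^ K * norm q \<Longrightarrow> norm (1 / qpoch_inf A (q ^ k)) \<le> D"
    using qpoch_inf_bounded_away_from_0[OF p(1) R] by metis
  show ?thesis unfolding bounded_holomorphic_family_def qpoch
  proof (intro conjI allI exI[of _ "C * D"] ballI)
    show "(\<lambda>t. qpoch_inf (A 0 t) (q ^ k) / qpoch_inf (A (int j + l) t) (q ^ k)) holomorphic_on ball 0 R" for j
      using nz[OF _ pos] p unfolding A_def by (intro holomorphic_intros) auto
    fix j t assume t: "t \<in> ball (0::complex) R"
    have "norm (qpoch_inf (A 0 t) (q ^ k) * (1 / qpoch_inf (A (int j + l) t) (q ^ k))) \<le> C * D"
      unfolding norm_mult using t e C(1) D(1)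
      by (intro mult_mono C(2) D(2) norm_A pos) auto
    then show "norm (qpoch_inf (A 0 t) (q ^ k) / qpoch_inf (A (int j + l) t) (q ^ k)) \<le> C * D"
      by simp
  qed (use C D in auto)
qed

text \<open>
  Here \<open>(A p\<^sup>n;p)\<^sub>\<infinity>\<close> stands in the numerator, so its argument may lie anywhere in a fixed disc, and
  \<open>l\<close> is arbitrary. A zero of it is a zero of the inverse symbol, in accordance with the
  convention \<open>1 / (A;p)\<^sub>n = 0\<close>.
\<close>

lemma bounded_holomorphic_family_inverse_qpoch:
  assumes q: "q \<in> qdisc" and d: "d = 1 \<or> d = -1" and e: "e \<ge> 1" and k: "k \<ge> 1"
    and R: "R ^ K * norm q < 1"
  shows "bounded_holomorphic_family R (\<lambda>j t. 1 / qpoch (of_int d * t ^ K * q ^ e) (q ^ k) (int j + l))"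
proof -
  define A where "A = (\<lambda>n t. of_int d * t ^ K * q powi (int e + int k * n))"
  define \<rho> where "\<rho> = R ^ K * norm q powi (int e + int k * l)"
  note p = norm_power_less_1[OF q k]
  have qpoch: "1 / qpoch (of_int d * t ^ K * q ^ e) (q ^ k) n = qpoch_inf (A n t) (q ^ k) / qpoch_inf (A 0 t) (q ^ k)" for n t
    using q by (simp add: qpoch_def A_def monomial_shift)
  have norm_A0: "norm (A 0 t) \<le> R ^ K * norm q" if "t \<in> ball 0 R" for t
    using norm_monomial_le[of q d 1 "int e" t R K] that q d e unfolding A_def by simp
  have norm_A: "norm (A (int j + l) t) \<le> \<rho>" if "t \<in> ball 0 R" for j t
    unfolding \<rho>_def A_def
    by (rule norm_monomial_le) (use that q d in \<open>auto simp: distrib_left\<close>)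
  have nz: "qpoch_inf (A 0 t) (q ^ k) \<noteq> 0" if "t \<in> ball 0 R" for t
    using norm_A0[OF that] R p by (intro qpoch_inf_nonzero) auto
  obtain C where C: "C > 0" "\<And>A. norm A \<le> \<rho> \<Longrightarrow> norm (qpoch_inf A (q ^ k)) \<le> C"
    using qpoch_inf_bounded[OF p(1)] by metis
  obtain D where D: "D > 0" "\<And>A. norm A \<le> R ^ K * norm q \<Longrightarrow> norm (1 / qpoch_inf A (q ^ k)) \<le> D"
    using qpoch_inf_bounded_away_from_0[OF p(1) R] by metis
  show ?thesis unfolding bounded_holomorphic_family_def qpoch
  proof (intro conjI allI exI[of _ "C * D"] ballI)
    show "(\<lambda>t. qpoch_inf (A (int j + l) t) (q ^ k) / qpoch_inf (A 0 t) (q ^ k)) holomorphic_on ball 0 R" for j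
      using nz p unfolding A_def by (intro holomorphic_intros) auto
    fix j t assume t: "t \<in> ball (0::complex) R"
    have "norm (qpoch_inf (A (int j + l) t) (q ^ k) * (1 / qpoch_inf (A 0 t) (q ^ k))) \<le> C * D"
      unfolding norm_mult using t C(1) D(1)
      by (intro mult_mono C(2) D(2) norm_A norm_A0) auto
    then show "norm (qpoch_inf (A (int j + l) t) (q ^ k) / qpoch_inf (A 0 t) (q ^ k)) \<le> C * D"
      by simp
  qed (use C D in auto)
qed

section \<open>Power series of a locally uniform sum\<close>

lemma summable_quadratic_exponent:
  fixes x y :: real
  assumes "0 < x" "x < 1" "y \<ge> 0" "b \<ge> 1"
  shows "summable (\<lambda>j. y ^ j * x powi (int b * int j ^ 2 + c * int j))"
proof (rule summable_comparison_test_ev)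
  have "x ^ b < 1" using assms by (simp add: power_less_one_iff)
  then have "(\<lambda>j. y * x powi c * (x ^ b) ^ j) \<longlonglongrightarrow> y * x powi c * 0"
    using assms by (intro tendsto_intros LIMSEQ_power_zero) auto
  then have "eventually (\<lambda>j. y * x powi c * (x ^ b) ^ j < 1 / 2) sequentially"
    by (intro order_tendstoD) auto
  then show "eventually (\<lambda>j. norm (y ^ j * x powi (int b * int j ^ 2 + c * int j)) \<le> (1 / 2) ^ j) sequentially"
  proof eventually_elim
    case (elim j)
    \<comment> \<open>Root test: the exponent of \<open>x\<close> is divisible by \<open>j\<close>, and the \<open>j\<close>-th root of the term tends to 0.\<close>
    have "y ^ j * x powi (int b * int j ^ 2 + c * int j) = (y * x powi c * (x ^ b) ^ j) ^ j"
    proof -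
      have "x powi (int b * int j ^ 2 + c * int j) = x powi ((c + int (b * j)) * int j)"
        by (simp add: algebra_simps power2_eq_square)
      also have "\<dots> = (x powi (c + int (b * j))) ^ j"
        by (simp only: power_int_power')
      also have "x powi (c + int (b * j)) = x powi c * (x ^ b) ^ j"
        using assms by (simp add: power_int_add power_mult del: of_nat_mult)
      finally show ?thesis by (simp add: power_mult_distrib)
    qed
    also have "\<dots> \<le> (1 / 2) ^ j"
      using elim assms by (intro power_mono) auto
    finally show ?case using assms by simp
  qed
qed (auto intro: summable_geometric)

text \<open>
  Derivatives at 0 commute with locally uniform limits (Weierstrass), so the \<open>n\<close>-th coefficient of the sum is
  the limit of the coefficients of the partial sums; the vanishing hypothesis makes this sequence
  constant from \<open>n + 1\<close> on.
\<close>

lemma sums_power_series_of_uniform_sum: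
  fixes h :: "nat \<Rightarrow> complex \<Rightarrow> complex"
  assumes holo: "\<And>j. h j holomorphic_on ball 0 R"
    and ulim: "uniform_limit (ball 0 R) (\<lambda>N t. \<Sum>j<N. h j t) H sequentially"
    and exp: "\<And>j. h j has_fps_expansion Abs_fps (\<Phi> j)"
    and vanish: "\<And>n j. n < j \<Longrightarrow> \<Phi> j n = 0"
    and t: "t \<in> ball 0 R"
  shows "(\<lambda>n. (\<Sum>j\<le>n. \<Phi> j n) * t ^ n) sums H t"
proof -
  have R: "0 \<in> ball (0::complex) R"
    using t by (auto intro: le_less_trans[OF norm_ge_zero])
  have sum_holo: "(\<lambda>t. \<Sum>j<N. h j t) holomorphic_on ball 0 R" for N
    by (intro holomorphic_intros holo)
  have "H holomorphic_on ball 0 R"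
  proof (rule holomorphic_uniform_sequence[OF open_ball sum_holo])
    fix x :: complex assume "x \<in> ball 0 R"
    then obtain d where "d > 0" "cball x d \<subseteq> ball 0 R"
      by (meson open_ball open_contains_cball)
    then show "\<exists>d>0. cball x d \<subseteq> ball 0 R \<and>
        uniform_limit (cball x d) (\<lambda>N t. \<Sum>j<N. h j t) H sequentially"
      using uniform_limit_on_subset[OF ulim] by blast
  qed
  then have "(\<lambda>n. (deriv ^^ n) H 0 / fact n * (t - 0) ^ n) sums H t"
    by (rule holomorphic_power_series[OF _ t])
  moreover have "(deriv ^^ n) H 0 / fact n = (\<Sum>j\<le>n. \<Phi> j n)" for n
  proof (rule LIMSEQ_unique)
    show "(\<lambda>N. (deriv ^^ n) (\<lambda>t. \<Sum>j<N. h j t) 0 / fact n) \<longlonglongrightarrow> (deriv ^^ n) H 0 / fact n"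
      by (intro tendsto_intros higher_deriv_complex_uniform_limit[OF ulim] R always_eventually)
         (auto intro: sum_holo)
    have "(deriv ^^ n) (\<lambda>t. \<Sum>j<N. h j t) 0 / fact n = (\<Sum>j\<le>n. \<Phi> j n)" if "N > n" for N
    proof -
      have "(\<lambda>t. \<Sum>j<N. h j t) has_fps_expansion (\<Sum>j<N. Abs_fps (\<Phi> j))"
        by (intro has_fps_expansion_sum exp)
      from fps_nth_fps_expansion[OF this, of n]
      have "(deriv ^^ n) (\<lambda>t. \<Sum>j<N. h j t) 0 / fact n = (\<Sum>j<N. \<Phi> j n)"
        by (simp add: fps_sum_nth)
      also have "\<dots> = (\<Sum>j\<le>n. \<Phi> j n)"
        using that by (intro sum.mono_neutral_right) (auto simp: vanish)
      finally show ?thesis .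
    qed
    then show "(\<lambda>N. (deriv ^^ n) (\<lambda>t. \<Sum>j<N. h j t) 0 / fact n) \<longlonglongrightarrow> (\<Sum>j\<le>n. \<Phi> j n)"
      by (intro tendsto_eventually eventually_sequentiallyI[of "Suc n"]) auto
  qed
  ultimately show ?thesis by simp
qed

text \<open>
  Convergence at a point beyond 1 makes the series for \<open>H\<close> absolutely convergent in the closed unit
  disc. Dividing by \<open>1 - t\<close> replaces the coefficients by their partial sums (Cauchy product with
  the geometric series), and these tend to the value at 1.
\<close>

lemma power_series_beyond_unit_disc:
  fixes C :: "nat \<Rightarrow> complex"
  assumes R: "R > 1" and H: "\<forall>t\<in>ball 0 R. (\<lambda>n. C n * t ^ n) sums H t"
  shows "t \<in> ball 0 1 \<Longrightarrow> (\<lambda>n. (\<Sum>i\<le>n. C i) * t ^ n) sums (H t / (1 - t))"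
    and "(\<lambda>n. \<Sum>i\<le>n. C i) \<longlonglongrightarrow> H 1"
    and "((\<lambda>t::real. H (of_real t)) \<longlongrightarrow> H 1) (at_left 1)"
proof -
  have sums: "(\<lambda>n. C n * t ^ n) sums H t" if "t \<in> ball 0 R" for t
    using H that by blast
  show "(\<lambda>n. \<Sum>i\<le>n. C i) \<longlonglongrightarrow> H 1"
    using sums[of 1] R by (simp add: sums_def_le)
  show "(\<lambda>n. (\<Sum>i\<le>n. C i) * t ^ n) sums (H t / (1 - t))" if t: "t \<in> ball 0 1"
  proof -
    have "summable (\<lambda>n. norm (C n * t ^ n))"
    proof (rule powser_insidea)
      show "summable (\<lambda>n. C n * 1 ^ n)" using sums[of 1] R by (auto simp: sums_iff)
    qed (use t in auto)
    moreover have "summable (\<lambda>n. norm (t ^ n))"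
      using t by (simp add: norm_power summable_geometric)
    ultimately have "(\<lambda>n. \<Sum>i\<le>n. C i * t ^ i * t ^ (n - i)) sums ((\<Sum>n. C n * t ^ n) * (\<Sum>n. t ^ n))"
      by (rule Cauchy_product_sums)
    moreover have "(\<Sum>n. C n * t ^ n) = H t"
      using sums[of t] t R by (auto simp: sums_iff)
    moreover have "(\<Sum>n. t ^ n) = 1 / (1 - t)"
      using t by (intro suminf_geometric) auto
    moreover have "(\<Sum>i\<le>n. C i * t ^ i * t ^ (n - i)) = (\<Sum>i\<le>n. C i) * t ^ n" for n
      by (simp add: sum_distrib_right mult.assoc flip: power_add)
    ultimately show ?thesis by simp
  qed
  have "isCont (\<lambda>t. \<Sum>n. C n * t ^ n) 1"
  proof (rule isCont_powser)
    show "summable (\<lambda>n. C n * (of_real ((1 + R) / 2)) ^ n)"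
      using sums[of "of_real ((1 + R) / 2)"] R by (auto simp: sums_iff simp flip: of_real_add of_real_divide)
  qed (use R in \<open>auto simp flip: of_real_add of_real_divide\<close>)
  then have "((\<lambda>t. \<Sum>n. C n * t ^ n) \<longlongrightarrow> (\<Sum>n. C n * 1 ^ n)) (at 1)"
    by (simp add: isCont_def)
  moreover have "filterlim (\<lambda>t::real. of_real t :: complex) (at 1) (at_left 1)"
    unfolding filterlim_at
    by (auto intro!: tendsto_eq_intros simp: eventually_at_filter)
  ultimately have "((\<lambda>t::real. \<Sum>n. C n * (of_real t) ^ n) \<longlongrightarrow> (\<Sum>n. C n * 1 ^ n)) (at_left 1)"
    by (rule filterlim_compose)
  moreover have "(\<Sum>n. C n * 1 ^ n) = H 1"
    using sums[of 1] R by (auto simp: sums_iff)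
  moreover have "eventually (\<lambda>t::real. (\<Sum>n. C n * (of_real t) ^ n) = H (of_real t)) (at_left 1)"
  proof -
    have "eventually (\<lambda>t::real. t \<in> {0<..<1}) (at_left 1)"
      by (rule eventually_at_left_real) simp
    then show ?thesis
    proof eventually_elim
      case (elim t)
      then show ?case using sums[of "of_real t"] R by (auto simp: sums_iff)
    qed
  qed
  ultimately show "((\<lambda>t::real. H (of_real t)) \<longlongrightarrow> H 1) (at_left 1)"
    by (simp add: tendsto_cong)
qed

section \<open>Rational functions of q and t\<close>

lemma rational2_cong:
  assumes "is_rational_function2 R" "\<And>q t. q \<in> qdisc \<Longrightarrow> t \<in> ball 0 1 \<Longrightarrow> R q t = R' q t"
  shows "is_rational_function2 R'"
  using assms unfolding is_rational_function2_def by metis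

lemma rational2_poly2:
  "is_rational_function2 (poly2 N)"
  unfolding is_rational_function2_def by (intro exI[of _ N] exI[of _ 1]) (simp add: poly2_def)

lemma rational2_divide:
  assumes "is_rational_function2 R" "is_rational_function2 R'"
    and nz: "\<And>q t. q \<in> qdisc \<Longrightarrow> t \<in> ball 0 1 \<Longrightarrow> R' q t \<noteq> 0"
  shows "is_rational_function2 (\<lambda>q t. R q t / R' q t)"
proof -
  from assms obtain N D N' D' where *: "\<And>q t. q \<in> qdisc \<Longrightarrow> t \<in> ball 0 1 \<Longrightarrow>
      poly2 D q t \<noteq> 0 \<and> R q t = poly2 N q t / poly2 D q t \<and>
      poly2 D' q t \<noteq> 0 \<and> R' q t = poly2 N' q t / poly2 D' q t"
    unfolding is_rational_function2_def by metis
  show ?thesis unfolding is_rational_function2_def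
  proof (rule exI[of _ "N * D'"], rule exI[of _ "D * N'"], intro ballI)
    fix q t :: complex assume qt: "q \<in> qdisc" "t \<in> ball 0 1"
    from *[OF qt] nz[OF qt]
    show "poly2 (D * N') q t \<noteq> 0 \<and> R q t / R' q t = poly2 (N * D') q t / poly2 (D * N') q t"
      by (auto simp: poly2_def)
  qed
qed

lemma rational2_mult:
  assumes "is_rational_function2 R" "is_rational_function2 R'"
  shows "is_rational_function2 (\<lambda>q t. R q t * R' q t)"
proof -
  from assms obtain N D N' D' where *: "\<And>q t. q \<in> qdisc \<Longrightarrow> t \<in> ball 0 1 \<Longrightarrow>
      poly2 D q t \<noteq> 0 \<and> R q t = poly2 N q t / poly2 D q t \<and>
      poly2 D' q t \<noteq> 0 \<and> R' q t = poly2 N' q t / poly2 D' q t"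
    unfolding is_rational_function2_def by metis
  show ?thesis unfolding is_rational_function2_def
  proof (rule exI[of _ "N * N'"], rule exI[of _ "D * D'"], intro ballI)
    fix q t :: complex assume qt: "q \<in> qdisc" "t \<in> ball 0 1"
    from *[OF qt]
    show "poly2 (D * D') q t \<noteq> 0 \<and> R q t * R' q t = poly2 (N * N') q t / poly2 (D * D') q t"
      by (auto simp: poly2_def)
  qed
qed

lemma rational2_prod:
  assumes "\<And>i. i \<in> I \<Longrightarrow> is_rational_function2 (F i)"
  shows "is_rational_function2 (\<lambda>q t. \<Prod>i\<in>I. F i q t)"
  using assms
proof (induction I rule: infinite_finite_induct)
  case (insert i I)
  then show ?case by (simp add: rational2_mult)
qed (use rational2_poly2[of 1] in \<open>simp_all add: poly2_def [abs_def]\<close>)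

text \<open>
  A negative power of \<open>q\<close> is put into the denominator, where it has no zero in the punctured disc.
\<close>

lemma rational2_monomial:
  "is_rational_function2 (\<lambda>q t. z * t ^ K * q powi E)"
proof (rule rational2_cong)
  show "is_rational_function2 (\<lambda>q t. poly2 (monom (monom z (nat E)) K) q t / poly2 (monom (monom 1 (nat (- E))) 0) q t)"
    by (intro rational2_divide rational2_poly2) (simp add: poly2_def poly_monom)
qed (simp add: poly2_def poly_monom power_int_def field_simps)

lemma rational2_factor:
  "is_rational_function2 (\<lambda>q t. 1 - z * t ^ K * q powi E)"
proof (rule rational2_cong)
  show "is_rational_function2 (\<lambda>q t. poly2 (monom (monom 1 (nat (- E))) 0 - monom (monom z (nat E)) K) q t /
      poly2 (monom (monom 1 (nat (- E))) 0) q t)"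
    by (intro rational2_divide rational2_poly2) (simp add: poly2_def poly_monom)
qed (simp add: poly2_def poly_monom power_int_def field_simps)

lemma factor_nonzero:
  fixes q t :: complex
  assumes "q \<in> qdisc" "t \<in> ball 0 1" "d = 1 \<or> d = -1" "E > 0"
  shows "1 - of_int d * t ^ K * q powi E \<noteq> 0"
proof
  assume "1 - of_int d * t ^ K * q powi E = 0"
  then have "norm (of_int d * t ^ K * q powi E) = 1" by simp
  moreover have "norm (of_int d * t ^ K * q powi E) \<le> norm t ^ K * norm q"
    using norm_monomial_le[of q d 1 E t "norm t" K] assms by simp
  ultimately show False using norm_t_power_less_1[OF assms(1,2), of K] by simp
qed

lemma rational2_qpoch:
  assumes "d = 1 \<or> d = -1" "e \<ge> 1" "k \<ge> 1" "int e + int k * n > 0"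
  shows "is_rational_function2 (\<lambda>q t. qpoch (of_int d * t ^ K * q ^ e) (q ^ k) n)"
proof (rule rational2_cong)
  have "int e + int k * i > 0" if "i \<in> {n..<0}" for i
    by (rule less_le_trans[OF assms(4)]) (use that in \<open>auto intro!: mult_left_mono\<close>)
  then show "is_rational_function2 (\<lambda>q t. (\<Prod>i\<in>{0..<n}. 1 - of_int d * t ^ K * q powi (int e + int k * i)) /
    (\<Prod>i\<in>{n..<0}. 1 - of_int d * t ^ K * q powi (int e + int k * i)))"
    using assms(1) by (intro rational2_divide rational2_prod rational2_factor)
      (auto simp: factor_nonzero simp del: right_minus_eq)
qed (use assms in \<open>simp add: qpoch_monomial norm_t_power_less_1\<close>)

lemma rational2_inverse_qpoch:
  assumes "d = 1 \<or> d = -1" "e \<ge> 1" "k \<ge> 1"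
  shows "is_rational_function2 (\<lambda>q t. 1 / qpoch (of_int d * t ^ K * q ^ e) (q ^ k) n)"
proof (rule rational2_cong)
  have "int e + int k * i > 0" if "i \<in> {0..<n}" for i
    using that assms by (auto intro: add_pos_nonneg)
  then show "is_rational_function2 (\<lambda>q t. (\<Prod>i\<in>{n..<0}. 1 - of_int d * t ^ K * q powi (int e + int k * i)) /
    (\<Prod>i\<in>{0..<n}. 1 - of_int d * t ^ K * q powi (int e + int k * i)))"
    using assms(1) by (intro rational2_divide rational2_prod rational2_factor)
      (auto simp: factor_nonzero simp del: right_minus_eq)
qed (use assms in \<open>simp add: qpoch_monomial norm_t_power_less_1\<close>)

section \<open>Rogers-Ramanujan type series and their generalization\<close>

locale rogers_ramanujan_data =
  fixes a b :: nat and c :: int and m r :: nat and d :: "nat \<Rightarrow> int" and e k :: "nat \<Rightarrow> nat"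
    and l :: "nat \<Rightarrow> int" and s :: nat and \<delta> :: "nat \<Rightarrow> int" and \<epsilon> \<kappa> :: "nat \<Rightarrow> nat"
    and lam :: "nat \<Rightarrow> int"
  assumes b_pos: "b \<ge> 1" and m_pos: "m \<ge> 1"
    and num: "\<And>i. i \<in> {1..r} \<Longrightarrow> (d i = 1 \<or> d i = -1) \<and> e i \<ge> 1 \<and> k i \<ge> 1"
    and den: "\<And>i. i \<in> {1..s} \<Longrightarrow> (\<delta> i = 1 \<or> \<delta> i = -1) \<and> \<epsilon> i \<ge> 1 \<and> \<kappa> i \<ge> 1"
    and dvd_2b: "gcd_param m r k s \<kappa> dvd 2 * b"
    and regular: "\<And>i. i \<in> {1..r} \<Longrightarrow> int (e i) + int (k i) * l i > 0"
begin

abbreviation g :: nat where "g \<equiv> gcd_param m r k s \<kappa>"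

abbreviation gen_term :: "complex \<Rightarrow> complex \<Rightarrow> nat \<Rightarrow> complex" where
  "gen_term \<equiv> rr_gen_term a b c m r d e k l s \<delta> \<epsilon> \<kappa> lam"

abbreviation gen :: "complex \<Rightarrow> complex \<Rightarrow> complex" where
  "gen \<equiv> rr_gen a b c m r d e k l s \<delta> \<epsilon> \<kappa> lam"

abbreviation series :: "complex \<Rightarrow> complex" where
  "series \<equiv> rr_series a b c m r d e k l s \<delta> \<epsilon> \<kappa> lam"

text \<open>
  The factor of the \<open>j\<close>-th term that is built from the parameters indexed by \<open>i\<close>; the denominator
  symbols enter as inverses, since it is the inverse symbols that are holomorphic.
\<close>

definition pochs :: "complex \<Rightarrow> complex \<Rightarrow> nat \<Rightarrow> complex" where
  "pochs q t j = (\<Prod>i=1..r. qpoch (of_int (d i) * t ^ (k i div g) * q ^ e i) (q ^ k i) (int j + l i)) *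
     (\<Prod>i=1..s. 1 / qpoch (of_int (\<delta> i) * t ^ (\<kappa> i div g) * q ^ \<epsilon> i) (q ^ \<kappa> i) (int j + lam i))"

text \<open>
  The \<open>j\<close>-th term of \<open>(1 - t) f(q,t)\<close>, with \<open>(t;q\<^sup>m)\<^sub>j\<^sub>+\<^sub>1\<close> replaced by \<open>(t q\<^sup>m;q\<^sup>m)\<^sub>j\<close>, so that it is also
  meaningful at \<open>t = 1\<close>. The power of \<open>t\<close> is kept in front because it determines which
  coefficients vanish.
\<close>

definition reduced_term :: "complex \<Rightarrow> complex \<Rightarrow> nat \<Rightarrow> complex" where
  "reduced_term q t j = t ^ ((2 * b div g) * j) *
     ((-1) ^ (a * j) * q powi (int b * int j ^ 2 + c * int j) *
      (pochs q t j * (1 / qpoch (t * q ^ m) (q ^ m) (int j))))"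

lemma g_pos: "g \<ge> 1"
  using m_pos by (simp add: gcd_param_def Suc_le_eq)

lemma
  shows g_dvd_k: "i \<in> {1..r} \<Longrightarrow> g dvd k i" and g_dvd_kappa: "i \<in> {1..s} \<Longrightarrow> g dvd \<kappa> i"
  unfolding gcd_param_def by (rule Gcd_dvd, blast)+

lemma t_exponents_pos:
  shows "2 * b div g \<ge> 1" and "i \<in> {1..r} \<Longrightarrow> k i div g \<ge> 1" and "i \<in> {1..s} \<Longrightarrow> \<kappa> i div g \<ge> 1"
proof -
  have *: "n div g \<ge> 1" if "g dvd n" "n \<ge> 1" for n
    using that by (metis One_nat_def Suc_leI div_greater_zero_iff dvd_imp_le g_pos less_le_trans zero_less_one)
  show "2 * b div g \<ge> 1" using * dvd_2b b_pos by simp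
  show "i \<in> {1..r} \<Longrightarrow> k i div g \<ge> 1" using * g_dvd_k num by blast
  show "i \<in> {1..s} \<Longrightarrow> \<kappa> i div g \<ge> 1" using * g_dvd_kappa den by blast
qed

lemma gen_term_eq:
  "gen_term q t j = t ^ ((2 * b div g) * j) * ((-1) ^ (a * j) * q powi (int b * int j ^ 2 + c * int j) *
      (pochs q t j * (1 / qpoch t (q ^ m) (int j + 1))))"
  by (simp add: rr_gen_term_def pochs_def Let_def prod_dividef mult_ac)

lemma reduced_term_eq:
  assumes "q \<in> qdisc" "t \<in> ball 0 1"
  shows "reduced_term q t j = (1 - t) * gen_term q t j"
proof -
  have "t \<noteq> 1" using assms by auto
  have "(1 - t) * qpoch (t * q ^ m) (q ^ m) (int j) = qpoch t (q ^ m) (int j + 1)"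
    by (rule qpoch_shift_base) (use norm_power_less_1[OF assms(1) m_pos] in auto)
  from this[symmetric] show ?thesis
    using \<open>t \<noteq> 1\<close> by (simp add: gen_term_eq reduced_term_def)
qed

lemma suminf_reduced_term_at_1: "(\<Sum>j. reduced_term q 1 j) = series q"
  by (simp add: rr_series_def reduced_term_def pochs_def prod_dividef mult_ac)

text \<open>
  Finitely many strict inequalities that hold at \<open>R = 1\<close> persist slightly to the right of 1.
\<close>

lemma radius_beyond_1:
  assumes "q \<in> qdisc"
  obtains R where "R > 1" "R * norm q < 1" "\<And>i. i \<in> {1..r} \<Longrightarrow> R ^ (k i div g) * norm q < 1"
    "\<And>i. i \<in> {1..s} \<Longrightarrow> R ^ (\<kappa> i div g) * norm q < 1"
proof -
  have *: "eventually (\<lambda>R. R ^ n * norm q < 1) (at_right 1)" for n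
  proof -
    have "((\<lambda>R. R ^ n * norm q) \<longlongrightarrow> 1 ^ n * norm q) (at_right 1)"
      by (intro tendsto_intros)
    then show ?thesis using assms by (intro order_tendstoD(2)) auto
  qed
  have "eventually (\<lambda>R. R > 1 \<and> R ^ 1 * norm q < 1 \<and> (\<forall>i\<in>{1..r}. R ^ (k i div g) * norm q < 1) \<and>
      (\<forall>i\<in>{1..s}. R ^ (\<kappa> i div g) * norm q < 1)) (at_right (1::real))"
    by (intro eventually_conj eventually_at_right_less eventually_ball_finite ballI *) auto
  then obtain R where "R > 1 \<and> R ^ 1 * norm q < 1 \<and> (\<forall>i\<in>{1..r}. R ^ (k i div g) * norm q < 1) \<and>
      (\<forall>i\<in>{1..s}. R ^ (\<kappa> i div g) * norm q < 1)"
    using eventually_happens'[OF trivial_limit_at_right_real] by blast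
  then show ?thesis using that by auto
qed

text \<open>
  The terms are \<open>O((R\<^sup>B)\<^sup>j |q|\<^sup>N)\<close> with \<open>B = 2b/g\<close> and \<open>N = b j\<^sup>2 + c j\<close>, uniformly for \<open>|t| < R\<close>, so the
  Weierstrass M-test applies on the whole disc.
\<close>

lemma reduced_terms_converge:
  assumes q: "q \<in> qdisc"
  shows "\<exists>R>1. (\<forall>j. (\<lambda>t. reduced_term q t j) holomorphic_on ball 0 R) \<and>
    uniform_limit (ball 0 R) (\<lambda>N t. \<Sum>j<N. reduced_term q t j) (\<lambda>t. \<Sum>j. reduced_term q t j) sequentially \<and>
    (\<forall>t\<in>ball 0 R. summable (reduced_term q t))"
proof -
  \<comment> \<open>\<open>R |q| < 1\<close> serves for \<open>(t q\<^sup>m;q\<^sup>m)\<^sub>j\<close>, whose argument has \<open>t\<close>-degree 1.\<close>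
  obtain R where R: "R > 1" "R * norm q < 1" "\<And>i. i \<in> {1..r} \<Longrightarrow> R ^ (k i div g) * norm q < 1"
      "\<And>i. i \<in> {1..s} \<Longrightarrow> R ^ (\<kappa> i div g) * norm q < 1"
    using radius_beyond_1[OF q] by metis
  define core where "core = (\<lambda>j t. pochs q t j * (1 / qpoch (t * q ^ m) (q ^ m) (int j)))"
  have "bounded_holomorphic_family R (\<lambda>j t. 1 / qpoch (t * q ^ m) (q ^ m) (int j))"
    using bounded_holomorphic_family_inverse_qpoch[of q 1 m m R 1 0] q R m_pos by simp
  then have "bounded_holomorphic_family R core"
    unfolding core_def pochs_def
    by (intro bounded_holomorphic_family_mult bounded_holomorphic_family_prod bounded_holomorphic_family_qpoch
        bounded_holomorphic_family_inverse_qpoch q R) (use num den regular in auto)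
  then obtain C where holo: "\<And>j. core j holomorphic_on ball 0 R"
      and C: "C \<ge> 0" "\<And>j t. t \<in> ball 0 R \<Longrightarrow> norm (core j t) \<le> C"
    unfolding bounded_holomorphic_family_def by blast
  define B where "B = 2 * b div g"
  define M where "M = (\<lambda>j. (R ^ B) ^ j * norm q powi (int b * int j ^ 2 + c * int j) * C)"
  have "summable M"
    unfolding M_def using q R(1) b_pos
    by (intro summable_mult2 summable_quadratic_exponent) auto
  have factored: "reduced_term q t j = t ^ (B * j) * ((-1) ^ (a * j) * q powi (int b * int j ^ 2 + c * int j) * core j t)" for t j
    by (simp add: reduced_term_def core_def B_def)
  have bound: "norm (reduced_term q t j) \<le> M j" if t: "t \<in> ball 0 R" for t j
  proof -
    have "norm (reduced_term q t j) = norm t ^ (B * j) * norm q powi (int b * int j ^ 2 + c * int j) * norm (core j t)"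
      by (simp add: factored norm_mult norm_power norm_power_int)
    also have "\<dots> \<le> R ^ (B * j) * norm q powi (int b * int j ^ 2 + c * int j) * C"
      using t R(1) C(2)[OF t] by (intro mult_mono power_mono) auto
    finally show ?thesis by (simp add: M_def power_mult)
  qed
  show ?thesis
  proof (intro exI[of _ R] conjI allI ballI)
    show "(\<lambda>t. reduced_term q t j) holomorphic_on ball 0 R" for j
      unfolding factored by (intro holomorphic_intros holo)
    show "uniform_limit (ball 0 R) (\<lambda>N t. \<Sum>j<N. reduced_term q t j) (\<lambda>t. \<Sum>j. reduced_term q t j) sequentially"
      by (rule Weierstrass_m_test[OF bound \<open>summable M\<close>])
    show "summable (reduced_term q t)" if "t \<in> ball 0 R" for t
      by (rule summable_comparison_test'[OF \<open>summable M\<close>]) (rule bound[OF that])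
  qed (rule R(1))
qed

lemma gen_term_summable:
  assumes "q \<in> qdisc" "t \<in> ball 0 1"
  shows "summable (gen_term q t)" and "(\<Sum>j. reduced_term q t j) = (1 - t) * gen q t"
proof -
  have t: "t \<noteq> 1" using assms by auto
  obtain R where "R > 1" and R: "\<And>t. t \<in> ball 0 R \<Longrightarrow> summable (reduced_term q t)"
    using reduced_terms_converge[OF assms(1)] by metis
  moreover have "t \<in> ball 0 R" using assms(2) \<open>R > 1\<close> by simp
  moreover have "reduced_term q t = (\<lambda>j. (1 - t) * gen_term q t j)"
    by (rule ext) (rule reduced_term_eq[OF assms])
  ultimately have "summable (\<lambda>j. (1 - t) * gen_term q t j)" by metis
  then show "summable (gen_term q t)" using t by (simp add: summable_cmult_iff)
  then show "(\<Sum>j. reduced_term q t j) = (1 - t) * gen q t"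
    by (simp add: reduced_term_eq[OF assms] rr_gen_def suminf_mult)
qed

text \<open>
  The exponents assumed to belong to \<open>S\<close> are the possibly negative ones: those of the leading
  power of \<open>q\<close> and those in denominator symbols with negative subscript. Coefficients below \<open>t\<^sup>j\<close>
  vanish because \<open>2b/g \<ge> 1\<close>.
\<close>

lemma taylor_coefficients_of_reduced_terms:
  assumes "coefficient_ring S"
    and "\<forall>j. coefficient_ring.exponent S (int b * int j ^ 2 + c * int j)"
    and "\<forall>i\<in>{1..s}. \<forall>E\<ge>int (\<epsilon> i) + int (\<kappa> i) * lam i. coefficient_ring.exponent S E"
  shows "\<exists>\<Phi>. \<forall>j. (\<forall>n. \<Phi> j n \<in> S) \<and> (\<forall>n q. n < j \<longrightarrow> \<Phi> j n q = 0) \<and>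
    (\<forall>q\<in>qdisc. (\<lambda>t. reduced_term q t j) has_fps_expansion Abs_fps (\<lambda>n. \<Phi> j n q))"
proof -
  interpret coefficient_ring S by fact
  have "\<exists>\<Phi>. (\<forall>n. \<Phi> n \<in> S) \<and> (\<forall>n q. n < j \<longrightarrow> \<Phi> n q = 0) \<and>
      (\<forall>q\<in>qdisc. (\<lambda>t. reduced_term q t j) has_fps_expansion Abs_fps (\<lambda>n. \<Phi> n q))" for j
  proof -
    have "taylor_in (\<lambda>q t. 1 / qpoch (of_int 1 * t ^ 1 * q ^ m) (q ^ m) (int j))"
    proof (rule taylor_in_inverse_qpoch)
      show "exponent E" if "E \<ge> int m + int m * int j" for E
        by (rule exponent_nonneg, rule order_trans[OF _ that]) simp
    qed (use m_pos in auto)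
    then have t_poch: "taylor_in (\<lambda>q t. 1 / qpoch (t * q ^ m) (q ^ m) (int j))"
      by simp
    have "taylor_in (\<lambda>q t. pochs q t j)"
      unfolding pochs_def
    proof (intro taylor_in_mult taylor_in_prod)
      fix i assume i: "i \<in> {1..r}"
      have "int (e i) + int (k i) * (int j + l i) > 0"
        using regular[OF i] by (rule less_le_trans) (simp add: distrib_left)
      then show "taylor_in (\<lambda>q t. qpoch (of_int (d i) * t ^ (k i div g) * q ^ e i) (q ^ k i) (int j + l i))"
        using num[OF i] t_exponents_pos(2)[OF i] by (intro taylor_in_qpoch) auto
    next
      fix i assume i: "i \<in> {1..s}"
      have ge: "int (\<epsilon> i) + int (\<kappa> i) * lam i \<le> int (\<epsilon> i) + int (\<kappa> i) * (int j + lam i)"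
        by (simp add: distrib_left)
      show "taylor_in (\<lambda>q t. 1 / qpoch (of_int (\<delta> i) * t ^ (\<kappa> i div g) * q ^ \<epsilon> i) (q ^ \<kappa> i) (int j + lam i))"
      proof (rule taylor_in_inverse_qpoch)
        show "exponent E" if "E \<ge> int (\<epsilon> i) + int (\<kappa> i) * (int j + lam i)" for E
          using assms(3) i order_trans[OF ge that] by blast
      qed (use den[OF i] t_exponents_pos(3)[OF i] in auto)
    qed
    from taylor_in_mult[OF taylor_in_scaled_powi[OF assms(2)[rule_format]] taylor_in_mult[OF this t_poch]]
    have tay: "taylor_in (\<lambda>q t. (-1) ^ (a * j) * q powi (int b * int j ^ 2 + c * int j) *
        (pochs q t j * (1 / qpoch (t * q ^ m) (q ^ m) (int j))))" .
    have "\<exists>\<Phi>. (\<forall>n. \<Phi> n \<in> S) \<and> (\<forall>n q. n < 2 * b div g * j \<longrightarrow> \<Phi> n q = 0) \<and>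
        (\<forall>q\<in>qdisc. (\<lambda>t. reduced_term q t j) has_fps_expansion Abs_fps (\<lambda>n. \<Phi> n q))"
      by (rule taylor_in_shift[OF tay]) (rule reduced_term_def)
    moreover have "j \<le> 2 * b div g * j" using t_exponents_pos(1) by simp
    ultimately show ?thesis by (meson less_le_trans)
  qed
  then show ?thesis by (intro choice allI)
qed

lemma power_series_coefficients:
  assumes "coefficient_ring S"
    and "\<forall>j. coefficient_ring.exponent S (int b * int j ^ 2 + c * int j)"
    and "\<forall>i\<in>{1..s}. \<forall>E\<ge>int (\<epsilon> i) + int (\<kappa> i) * lam i. coefficient_ring.exponent S E"
  shows "\<exists>P. (\<forall>n. P n \<in> S) \<and> (\<forall>q\<in>qdisc.
    (\<forall>t\<in>ball 0 1. (\<lambda>n. P n q * t ^ n) sums gen q t) \<and>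
    (\<lambda>n. P n q) \<longlonglongrightarrow> series q \<and>
    ((\<lambda>t::real. (1 - of_real t) * gen q (of_real t)) \<longlongrightarrow> series q) (at_left 1))"
proof -
  obtain \<Phi> where \<Phi>: "\<And>j n. \<Phi> j n \<in> S" "\<And>j n q. n < j \<Longrightarrow> \<Phi> j n q = 0"
    "\<And>j q. q \<in> qdisc \<Longrightarrow> (\<lambda>t. reduced_term q t j) has_fps_expansion Abs_fps (\<lambda>n. \<Phi> j n q)"
    using taylor_coefficients_of_reduced_terms[OF assms] by blast
  define C where "C = (\<lambda>n q. \<Sum>j\<le>n. \<Phi> j n q)"
  define H where "H = (\<lambda>q t. \<Sum>j. reduced_term q t j)"
  have ex: "\<exists>R>1. \<forall>t\<in>ball 0 R. (\<lambda>n. C n q * t ^ n) sums H q t" if q: "q \<in> qdisc" for q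
  proof -
    obtain R where R: "R > 1" "\<forall>j. (\<lambda>t. reduced_term q t j) holomorphic_on ball 0 R"
      "uniform_limit (ball 0 R) (\<lambda>N t. \<Sum>j<N. reduced_term q t j) (\<lambda>t. \<Sum>j. reduced_term q t j) sequentially"
      using reduced_terms_converge[OF q] by (elim exE conjE)
    have "(\<lambda>n. C n q * t ^ n) sums H q t" if "t \<in> ball 0 R" for t
      unfolding C_def H_def
      by (rule sums_power_series_of_uniform_sum[OF R(2)[rule_format] R(3) \<Phi>(3)[OF q] \<Phi>(2) that])
    with R(1) show ?thesis by blast
  qed
  have H1: "H q 1 = series q" for q
    by (simp add: H_def suminf_reduced_term_at_1)
  show ?thesis
  proof (intro exI[of _ "\<lambda>n q. \<Sum>i\<le>n. C i q"] conjI allI ballI)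
    show "(\<lambda>q. \<Sum>i\<le>n. C i q) \<in> S" for n
      unfolding C_def by (intro coefficient_ring.sum[OF assms(1)] \<Phi>(1))
  next
    fix q assume q: "q \<in> qdisc"
    obtain R where R: "R > 1" "\<forall>t\<in>ball 0 R. (\<lambda>n. C n q * t ^ n) sums H q t"
      using ex[OF q] by (elim exE conjE)
    note conclusions = power_series_beyond_unit_disc[OF R, unfolded H1]
    show "(\<lambda>n. \<Sum>i\<le>n. C i q) \<longlonglongrightarrow> series q" by (rule conclusions)
    show "(\<lambda>n. (\<Sum>i\<le>n. C i q) * t ^ n) sums gen q t" if t: "t \<in> ball 0 1" for t
    proof -
      have "t \<noteq> 1" using t by auto
      then show ?thesis
        using conclusions(1)[OF t] gen_term_summable(2)[OF q t] by (simp add: H_def)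
    qed
    have "eventually (\<lambda>t::real. H q (of_real t) = (1 - of_real t) * gen q (of_real t)) (at_left 1)"
    proof -
      have "eventually (\<lambda>t::real. t \<in> {0<..<1}) (at_left 1)"
        by (rule eventually_at_left_real) simp
      then show ?thesis
        by eventually_elim (auto simp: H_def intro!: gen_term_summable(2)[OF q])
    qed
    then show "((\<lambda>t::real. (1 - of_real t) * gen q (of_real t)) \<longlongrightarrow> series q) (at_left 1)"
      using conclusions(3) by (simp add: tendsto_cong)
  qed
qed

text \<open>
  As \<open>g\<close> divides \<open>k\<^sub>i\<close>, the substitution multiplies the argument of each symbol by exactly its base
  \<open>q\<close> to the power \<open>k\<^sub>i\<close>, which raises the subscript by 1; likewise for \<open>\<kappa>\<^sub>i\<close>.
\<close>

lemma pochs_shift: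
  assumes "q \<in> qdisc" "t \<in> ball 0 1"
  shows "pochs q (t * q ^ g) j =
    (\<Prod>i=1..s. 1 - of_int (\<delta> i) * t ^ (\<kappa> i div g) * q ^ \<epsilon> i) /
    (\<Prod>i=1..r. 1 - of_int (d i) * t ^ (k i div g) * q ^ e i) * pochs q t (Suc j)"
proof -
  have shift: "qpoch (of_int d' * (t * q ^ g) ^ (k' div g) * q ^ e') (q ^ k') (int j + l') =
      qpoch (of_int d' * t ^ (k' div g) * q ^ e') (q ^ k') (int (Suc j) + l') /
      (1 - of_int d' * t ^ (k' div g) * q ^ e')" and
    nz: "1 - of_int d' * t ^ (k' div g) * q ^ e' \<noteq> 0"
    if "g dvd k'" "k' \<ge> 1" "e' \<ge> 1" "d' = 1 \<or> d' = -1" for d' k' e' l'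
  proof -
    show nz: "1 - of_int d' * t ^ (k' div g) * q ^ e' \<noteq> 0"
      using factor_nonzero[OF assms that(4), of "int e'" "k' div g"] that(3) by simp
    define A where "A = of_int d' * t ^ (k' div g) * q ^ e'"
    have "of_int d' * (t * q ^ g) ^ (k' div g) * q ^ e' = A * q ^ k'"
      using that(1) by (simp add: A_def power_mult_distrib flip: power_mult)
    moreover have "(1 - A) * qpoch (A * q ^ k') (q ^ k') (int j + l') = qpoch A (q ^ k') (int (Suc j) + l')"
      using qpoch_shift_base[of "q ^ k'" A "int j + l'"] norm_power_less_1[OF assms(1) that(2)]
      by (simp add: add_ac)
    ultimately have "qpoch (of_int d' * (t * q ^ g) ^ (k' div g) * q ^ e') (q ^ k') (int j + l') =
        qpoch A (q ^ k') (int (Suc j) + l') / (1 - A)"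
      using nz by (metis A_def nonzero_mult_div_cancel_left)
    then show "qpoch (of_int d' * (t * q ^ g) ^ (k' div g) * q ^ e') (q ^ k') (int j + l') =
      qpoch (of_int d' * t ^ (k' div g) * q ^ e') (q ^ k') (int (Suc j) + l') /
      (1 - of_int d' * t ^ (k' div g) * q ^ e')"
      by (simp only: A_def)
  qed
  have "pochs q (t * q ^ g) j =
    (\<Prod>i=1..r. qpoch (of_int (d i) * t ^ (k i div g) * q ^ e i) (q ^ k i) (int (Suc j) + l i) /
        (1 - of_int (d i) * t ^ (k i div g) * q ^ e i)) *
    (\<Prod>i=1..s. 1 / (qpoch (of_int (\<delta> i) * t ^ (\<kappa> i div g) * q ^ \<epsilon> i) (q ^ \<kappa> i) (int (Suc j) + lam i) /
        (1 - of_int (\<delta> i) * t ^ (\<kappa> i div g) * q ^ \<epsilon> i)))"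
    unfolding pochs_def
    by (intro arg_cong2[of _ _ _ _ "(*)"] prod.cong refl arg_cong[of _ _ "\<lambda>x. 1 / x"] shift)
       (use num den g_dvd_k g_dvd_kappa in auto)
  then show ?thesis
    by (simp add: pochs_def prod_dividef)
qed

text \<open>
  Besides the shift of the symbols this is the identity
  \<open>b (j+1)\<^sup>2 + c (j+1) = (b + c) + 2 b j + (b j\<^sup>2 + c j)\<close>. Its middle term is what the substitution
  produces from the power of \<open>t\<close>, whose exponent \<open>2bj/g\<close> is chosen for this purpose. The
  assumption \<open>m = g\<close> makes \<open>t q\<^sup>m\<close> the right argument for \<open>(t;q\<^sup>m)\<^sub>j\<^sub>+\<^sub>1\<close> too.
\<close>

lemma gen_term_shift:
  assumes "q \<in> qdisc" "t \<in> ball 0 1" "m = g"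
  shows "gen_term q t (Suc j) = (-1) ^ a * t ^ (2 * b div g) * q powi (int b + c) / (1 - t) *
    ((\<Prod>i=1..r. 1 - of_int (d i) * t ^ (k i div g) * q ^ e i) /
     (\<Prod>i=1..s. 1 - of_int (\<delta> i) * t ^ (\<kappa> i div g) * q ^ \<epsilon> i)) * gen_term q (t * q ^ m) j"
proof -
  define X where "X = (\<Prod>i=1..r. 1 - of_int (d i) * t ^ (k i div g) * q ^ e i)"
  define Y where "Y = (\<Prod>i=1..s. 1 - of_int (\<delta> i) * t ^ (\<kappa> i div g) * q ^ \<epsilon> i)"
  define B where "B = 2 * b div g"
  have nz: "1 - of_int d' * t ^ K * q ^ e' \<noteq> 0" if "d' = 1 \<or> d' = -1" "e' \<ge> 1" for d' K e'
    using factor_nonzero[OF assms(1,2) that(1), of "int e'" K] that(2) by simp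
  have XY: "X \<noteq> 0" "Y \<noteq> 0" unfolding X_def Y_def using nz num den by auto
  have q: "q \<noteq> 0" using assms by auto
  have t: "1 - t \<noteq> 0" using assms by auto
  have pochs: "pochs q (t * q ^ m) j = Y / X * pochs q t (Suc j)"
    using pochs_shift[OF assms(1,2)] assms(3) by (simp add: X_def Y_def)
  have qp: "(1 - t) * qpoch (t * q ^ m) (q ^ m) (int j + 1) = qpoch t (q ^ m) (int (Suc j) + 1)"
    using qpoch_shift_base[of "q ^ m" t "int j + 1"] norm_power_less_1[OF assms(1) m_pos]
    by (simp add: add_ac)
  have "(t * q ^ m) ^ (B * j) = t ^ (B * j) * q powi (2 * int b * int j)"
  proof -
    have "m * (B * j) = 2 * b * j"
      using dvd_2b assms(3) by (simp add: B_def)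
    then have "(q ^ m) ^ (B * j) = q ^ (2 * b * j)"
      by (simp only: power_mult[symmetric])
    also have "\<dots> = q powi (2 * int b * int j)"
      using power_int_of_nat[of q "2 * b * j"] by (simp del: power_int_of_nat)
    finally show ?thesis by (simp only: power_mult_distrib)
  qed
  moreover have "q powi (int b * int (Suc j) ^ 2 + c * int (Suc j)) =
      q powi (int b + c) * q powi (2 * int b * int j) * q powi (int b * int j ^ 2 + c * int j)"
  proof -
    have "int b * int (Suc j) ^ 2 + c * int (Suc j) =
        (int b + c) + 2 * int b * int j + (int b * int j ^ 2 + c * int j)"
      by (simp add: power2_eq_square algebra_simps)
    then show ?thesis using q by (simp only: power_int_add[OF disjI1[OF q]])
  qed
  ultimately show ?thesis
    using XY t unfolding gen_term_eq pochs X_def[symmetric] Y_def[symmetric] B_def[symmetric] qp[symmetric]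
    by (simp add: power_add)
qed

text \<open>
  Split off the term \<open>j = 0\<close> and apply the shift to the remaining terms; the zeroth term and the
  factor in the shift are rational without poles for \<open>|t| < 1\<close>.
\<close>

lemma q_difference_equation:
  assumes mg: "m = g"
  obtains R1 R2 where "is_rational_function2 R1" "is_rational_function2 R2"
    "\<And>q t. q \<in> qdisc \<Longrightarrow> t \<in> ball 0 1 \<Longrightarrow> gen q t = R1 q t + R2 q t * gen q (t * q ^ m)"
proof -
  define R1 where "R1 = (\<lambda>q t. gen_term q t 0)"
  define R2 where "R2 = (\<lambda>q t :: complex. (-1) ^ a * t ^ (2 * b div g) * q powi (int b + c) / (1 - t) *
    ((\<Prod>i=1..r. 1 - of_int (d i) * t ^ (k i div g) * q ^ e i) /
     (\<Prod>i=1..s. 1 - of_int (\<delta> i) * t ^ (\<kappa> i div g) * q ^ \<epsilon> i)))"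
  have nz: "1 - of_int d' * t ^ K * q ^ e' \<noteq> 0"
    if "d' = 1 \<or> d' = -1" "e' \<ge> 1" "q \<in> qdisc" "t \<in> ball 0 1" for d' K e' and q t :: complex
    using factor_nonzero[OF that(3,4,1), of "int e'" K] that(2) by simp
  have geometric: "is_rational_function2 (\<lambda>q t. 1 - t)"
    using rational2_factor[of 1 1 0] by simp
  have one_minus_nonzero: "1 - t \<noteq> 0" if "t \<in> ball 0 1" for t :: complex
    using that by auto
  show ?thesis
  proof (rule that[of R1 R2])
    have "is_rational_function2 (\<lambda>q t. pochs q t 0 / (1 - t))"
      unfolding pochs_def
      by (intro rational2_divide geometric rational2_mult rational2_prod rational2_qpoch rational2_inverse_qpoch)
         (use num den regular in auto)
    then show "is_rational_function2 R1"
    proof (rule rational2_cong)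
      fix q t :: complex assume qt: "q \<in> qdisc" "t \<in> ball 0 1"
      have "norm (t * q ^ m) < 1"
        using norm_mult_less[of t 1 "q ^ m" 1] norm_power_less_1[OF qt(1) m_pos] qt by simp
      then have "qpoch t (q ^ m) (0 + 1) = 1 - t"
        using qpoch_shift_base[of "q ^ m" t 0] qpoch_0[of "q ^ m" "t * q ^ m"]
          norm_power_less_1[OF qt(1) m_pos] by simp
      then show "pochs q t 0 / (1 - t) = R1 q t"
        by (simp add: R1_def gen_term_eq)
    qed
    have "is_rational_function2 (\<lambda>q t. 1 - z * t ^ K * q ^ n)" for z K n
      using rational2_factor[of z K "int n"] by simp
    then show "is_rational_function2 R2"
      unfolding R2_def
      by (intro rational2_mult[OF rational2_divide[OF rational2_monomial geometric]]
            rational2_divide rational2_prod)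
         (use den one_minus_nonzero in \<open>auto simp: nz simp del: right_minus_eq\<close>)
    fix q t :: complex assume qt: "q \<in> qdisc" "t \<in> ball 0 1"
    have tq: "t * q ^ m \<in> ball 0 1"
      using norm_mult_less[of t 1 "q ^ m" 1] norm_power_less_1[OF qt(1) m_pos] qt by simp
    have "gen q t = gen_term q t 0 + (\<Sum>j. gen_term q t (Suc j))"
      unfolding rr_gen_def using suminf_split_head[OF gen_term_summable(1)[OF qt]] by simp
    also have "(\<Sum>j. gen_term q t (Suc j)) = R2 q t * gen q (t * q ^ m)"
      unfolding gen_term_shift[OF qt mg] rr_gen_def R2_def
      by (rule suminf_mult[OF gen_term_summable(1)[OF qt(1) tq]])
    finally show "gen q t = R1 q t + R2 q t * gen q (t * q ^ m)"
      by (simp add: R1_def)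
  qed
qed

end

section \<open>The two-variable generalization\<close>

lemma quadratic_exponent_nonneg:
  fixes c :: int
  assumes "int b + c \<ge> 0"
  shows "int b * int j ^ 2 + c * int j \<ge> 0"
proof (cases j)
  case (Suc n)
  have "int b * int j \<ge> int b * 1" unfolding Suc by (intro mult_left_mono) auto
  then have "(int b * int j + c) * int j \<ge> 0" using assms by (intro mult_nonneg_nonneg) auto
  then show ?thesis by (simp add: power2_eq_square algebra_simps)
qed simp

theorem theorem2p1:
  fixes a b m r s g :: nat and c :: int
    and d \<delta> l lam :: "nat \<Rightarrow> int"
    and e k \<epsilon> \<kappa> :: "nat \<Rightarrow> nat"
    and \<phi> \<psi> :: "complex \<Rightarrow> complex"
    and f :: "complex \<Rightarrow> complex \<Rightarrow> complex"
  assumes "a = 0 \<or> a = 1" and "b \<ge> 1" and "m \<ge> 1"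
    and "\<forall>i\<in>{1..r}. (d i = 1 \<or> d i = -1) \<and> e i \<ge> 1 \<and> k i \<ge> 1"
    and "\<forall>i\<in>{1..s}. (\<delta> i = 1 \<or> \<delta> i = -1) \<and> \<epsilon> i \<ge> 1 \<and> \<kappa> i \<ge> 1"
    and "rogers_ramanujan_identity \<phi> \<psi>"
    and "\<forall>q\<in>qdisc. \<phi> q = rr_series a b c m r d e k l s \<delta> \<epsilon> \<kappa> lam q"
    and g_def: "g = gcd_param m r k s \<kappa>"
    and f_def: "f = rr_gen a b c m r d e k l s \<delta> \<epsilon> \<kappa> lam"
    and integral_exponents: "g dvd 2 * b"
    and regular: "\<forall>i\<in>{1..r}. int (e i) + int (k i) * l i > 0"
  shows "(\<exists>P :: nat \<Rightarrow> complex \<Rightarrow> complex.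
      (\<forall>n. is_laurent_polynomial (P n)) \<and>
      (b + c \<ge> 0 \<and> (\<forall>i\<in>{1..s}. int (\<epsilon> i) + int (\<kappa> i) * lam i \<ge> 0) \<longrightarrow> (\<forall>n. is_polynomial (P n))) \<and>
      (\<forall>q\<in>qdisc. \<forall>t\<in>ball 0 1.
          summable (rr_gen_term a b c m r d e k l s \<delta> \<epsilon> \<kappa> lam q t) \<and>
          (\<lambda>n. P n q * t ^ n) sums f q t) \<and>
      (\<forall>q\<in>qdisc.
          ((\<lambda>t::real. (1 - of_real t) * f q (of_real t)) \<longlongrightarrow> \<phi> q) (at_left 1) \<and>
          (\<lambda>n. P n q) \<longlonglongrightarrow> \<phi> q \<and> \<phi> q = \<psi> q)) \<and>
    (m = g \<longrightarrow> (\<exists>R1 R2. \<exists>K\<ge>1. is_rational_function2 R1 \<and> is_rational_function2 R2 \<and>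
      (\<forall>q\<in>qdisc. \<forall>t\<in>ball 0 1. f q t = R1 q t + R2 q t * f q (t * q ^ K))))"
proof -
  interpret rogers_ramanujan_data a b c m r d e k l s \<delta> \<epsilon> \<kappa> lam
    using assms by unfold_locales auto
  have \<phi>: "\<phi> q = \<psi> q" "\<phi> q = series q" if "q \<in> qdisc" for q
    using assms(6,7) that unfolding rogers_ramanujan_identity_def by blast+
  \<comment> \<open>Choosing the ring by cases yields a single family with the sharper conclusion whenever it is available.\<close>
  define S where "S = (if b + c \<ge> 0 \<and> (\<forall>i\<in>{1..s}. int (\<epsilon> i) + int (\<kappa> i) * lam i \<ge> 0)
    then {F. is_polynomial F} else {F. is_laurent_polynomial F})"
  have ring: "coefficient_ring S"
    unfolding S_def using coefficient_ring_polynomials coefficient_ring_laurent by auto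
  have exponents: "\<forall>j. coefficient_ring.exponent S (int b * int j ^ 2 + c * int j)"
    "\<forall>i\<in>{1..s}. \<forall>E\<ge>int (\<epsilon> i) + int (\<kappa> i) * lam i. coefficient_ring.exponent S E"
    using coefficient_ring.exponent_nonneg[OF coefficient_ring_polynomials] exponent_laurent
      quadratic_exponent_nonneg[of b c] unfolding S_def by (auto intro: order_trans)
  obtain P where P: "\<forall>n. P n \<in> S" "\<forall>q\<in>qdisc.
      (\<forall>t\<in>ball 0 1. (\<lambda>n. P n q * t ^ n) sums gen q t) \<and>
      (\<lambda>n. P n q) \<longlonglongrightarrow> series q \<and>
      ((\<lambda>t::real. (1 - of_real t) * gen q (of_real t)) \<longlongrightarrow> series q) (at_left 1)"
    using power_series_coefficients[OF ring exponents] by (elim exE conjE)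
  have laurent: "is_laurent_polynomial (P n)" for n
    using P(1)[rule_format, of n] polynomial_imp_laurent unfolding S_def by (auto split: if_splits)
  have polynomial: "is_polynomial (P n)"
    if "b + c \<ge> 0 \<and> (\<forall>i\<in>{1..s}. int (\<epsilon> i) + int (\<kappa> i) * lam i \<ge> 0)" for n
    using P(1)[rule_format, of n] that unfolding S_def by auto
  have recurrence: "\<exists>R1 R2. \<exists>K\<ge>1. is_rational_function2 R1 \<and> is_rational_function2 R2 \<and>
      (\<forall>q\<in>qdisc. \<forall>t\<in>ball 0 1. f q t = R1 q t + R2 q t * f q (t * q ^ K))" if "m = g"
  proof -
    obtain R1 R2 where "is_rational_function2 R1" "is_rational_function2 R2"
      "\<And>q t. q \<in> qdisc \<Longrightarrow> t \<in> ball 0 1 \<Longrightarrow> gen q t = R1 q t + R2 q t * gen q (t * q ^ m)"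
      using q_difference_equation \<open>m = g\<close> g_def by metis
    then show ?thesis using m_pos f_def by blast
  qed
  show ?thesis
  proof (intro conjI impI exI[of _ P] allI ballI recurrence)
    fix q :: complex assume q: "q \<in> qdisc"
    show "\<phi> q = \<psi> q" by (rule \<phi>(1)[OF q])
    show "(\<lambda>n. P n q) \<longlonglongrightarrow> \<phi> q" using P(2)[rule_format, OF q] \<phi>(2)[OF q] by simp
    show "((\<lambda>t::real. (1 - of_real t) * f q (of_real t)) \<longlongrightarrow> \<phi> q) (at_left 1)"
      using P(2)[rule_format, OF q] \<phi>(2)[OF q] f_def by simp
    fix t :: complex assume t: "t \<in> ball 0 1"
    show "summable (gen_term q t)" by (rule gen_term_summable(1)[OF q t])
    show "(\<lambda>n. P n q * t ^ n) sums f q t" using P(2)[rule_format, OF q] t f_def by simp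
  qed (use laurent polynomial in auto)
qed

end
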